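(* Consider a stable $GI/GI/1$ queue (without feedback), $\rho=b_H/a<1$, with service time distribution $H$, and let $\sigma^H_n$ be the service time of the $n$th arriving customer. If $H\in\mathcal{IRV}$, then, for the first busy period $B$, as $x\to\infty$, $$\mathbb{P}(B>x)\ \sim\ \sum_{n\ge1}\mathbb{P}(\tau^H\ge n)\,\mathbb{P}(\sigma^H_n>x(1-\rho))=\mathbb{E}\tau^H\,\mathbb{P}(\sigma^H_1>x(1-\rho)),$$ and, for any $\varepsilon>0$, one can choose $N=N(\varepsilon)\ge1$ such that, as $x\to\infty$, $$\mathbb{P}(B>x)\ \gtrsim\ \sum_{n=1}^N\mathbb{P}(\tau^H\ge n,\ \sigma^H_n\ge x(1-\rho))\ \gtrsim\ (1-\varepsilon)\,\mathbb{P}(B>x).$$ Furthermore, $$\{B>x\}\ \simeq\ \bigcup_{n\ge1}\{\tau^H\ge n,\ \sigma^H_n>x(1-\rho)\},\qquad x\to\infty.$$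
   Context: $GI/GI/1$ queue: customers arrive to a single server with i.i.d. inter-arrival times $t_1,t_2,\dots$ of finite mean $a>0$; the service times $\sigma^H_1,\sigma^H_2,\dots$ are i.i.d. nonnegative with distribution $H$ having finite mean $b_H>0$, independent of the inter-arrival times. The first customer arrives at an empty system. $\rho=b_H/a$. Let $\xi^H_i=\sigma^H_i-t_i$, $S^H_n=\sum_{i=1}^n\xi^H_i$; $\tau^H=\min\{n\ge1:S^H_n\le0\}$ is the number of customers served in the first busy period, and $B=\sum_{i=1}^{\tau^H}\sigma^H_i$ is the duration of the first busy period. A distribution $F$ with tail $\overline F=1-F$, $\overline F(x)>0$ for all $x$, belongs to $\mathcal{IRV}$ (intermediate regularly varying) if $\lim_{\alpha\downarrow1}\liminf_{x\to\infty}\overline F(\alpha x)/\overline F(x)=1$. For positive functions, $f(x)\sim g(x)$ means $f(x)/g(x)\to1$ and $f(x)\gtrsim g(x)$ means $\liminf_{x\to\infty}f(x)/g(x)\ge1$. For families of events of non-zero probabilities, $A_x\simeq B_x$ means $\mathbb{P}(A_x\Delta B_x)=o(\mathbb{P}(A_x))$ as $x\to\infty$, where $\Delta$ is the symmetric difference. *)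

theory Defs
  imports "HOL-Probability.Probability" "HOL-Library.Landau_Symbols" "HOL-Library.Extended_Nat"
begin

definition tail :: "real measure \<Rightarrow> real \<Rightarrow> real" where
  "tail F x = 1 - cdf F x"

definition intermediate_regularly_varying :: "real measure \<Rightarrow> bool" where
  "intermediate_regularly_varying F \<longleftrightarrow>
     (\<forall>x. tail F x > 0) \<and>
     ((\<lambda>\<alpha>. Liminf at_top (\<lambda>x. ereal (tail F (\<alpha> * x) / tail F x))) \<longlongrightarrow> 1) (at_right 1)"

text \<open>The relation is meant for functions that are positive near infinity.\<close>

definition asymp_ge :: "(real \<Rightarrow> real) \<Rightarrow> (real \<Rightarrow> real) \<Rightarrow> bool" (infix "\<greatersim>" 50) where
  "f \<greatersim> g \<longleftrightarrow> Liminf at_top (\<lambda>x. ereal (f x / g x)) \<ge> 1"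

definition asymp_same_events :: "'a measure \<Rightarrow> (real \<Rightarrow> 'a set) \<Rightarrow> (real \<Rightarrow> 'a set) \<Rightarrow> bool" where
  "asymp_same_events M A B \<longleftrightarrow>
     (\<forall>\<^sub>F x in at_top. A x \<in> sets M \<and> B x \<in> sets M \<and> measure M (A x) \<noteq> 0 \<and> measure M (B x) \<noteq> 0) \<and>
     (\<lambda>x. measure M ((A x - B x) \<union> (B x - A x))) \<in> o[at_top](\<lambda>x. measure M (A x))"

text \<open>Customers are numbered from 1; the values of \<open>t\<close> and \<open>\<sigma>\<close> at index 0 play no role.
  Since the increments are \<open>\<sigma> i - t i\<close>, the variable \<open>t i\<close> is the time between the arrivals
  of customers \<open>i\<close> and \<open>i + 1\<close>.\<close>

locale gi_gi_1_queue = prob_space M for M :: "'a measure" +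
  fixes t :: "nat \<Rightarrow> 'a \<Rightarrow> real" and \<sigma> :: "nat \<Rightarrow> 'a \<Rightarrow> real"
    and H :: "real measure" and a b :: real
  assumes indep_t: "indep_vars (\<lambda>_. borel) t {1..}"
    and ident_t: "\<And>i. i \<ge> 1 \<Longrightarrow> distr M borel (t i) = distr M borel (t 1)"
    and nonneg_t: "\<And>i. i \<ge> 1 \<Longrightarrow> AE \<omega> in M. 0 \<le> t i \<omega>"
    and integrable_t: "integrable M (t 1)"
    and mean_t: "expectation (t 1) = a"
    and a_pos: "a > 0"
    and indep_\<sigma>: "indep_vars (\<lambda>_. borel) \<sigma> {1..}"
    and distr_\<sigma>: "\<And>i. i \<ge> 1 \<Longrightarrow> distr M borel (\<sigma> i) = H"
    and nonneg_\<sigma>: "\<And>i. i \<ge> 1 \<Longrightarrow> AE \<omega> in M. 0 \<le> \<sigma> i \<omega>"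
    and integrable_H: "integrable H (\<lambda>x. x)"
    and mean_H: "(\<integral>x. x \<partial>H) = b"
    and b_pos: "b > 0"
    and indep_t_\<sigma>: "indep_var
          (PiM {1..} (\<lambda>_. borel)) (\<lambda>\<omega>. \<lambda>i\<in>{1..}. t i \<omega>)
          (PiM {1..} (\<lambda>_. borel)) (\<lambda>\<omega>. \<lambda>i\<in>{1..}. \<sigma> i \<omega>)"

definition walk :: "(nat \<Rightarrow> 'a \<Rightarrow> real) \<Rightarrow> (nat \<Rightarrow> 'a \<Rightarrow> real) \<Rightarrow> nat \<Rightarrow> 'a \<Rightarrow> real" where
  "walk t \<sigma> n \<omega> = (\<Sum>i=1..n. (\<sigma> i \<omega> - t i \<omega>))"

text \<open>The value is \<open>\<infinity>\<close> (the infimum of the empty set) if the walk stays positive forever;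
  the busy period then is the full series of service times.\<close>

definition num_served :: "(nat \<Rightarrow> 'a \<Rightarrow> real) \<Rightarrow> (nat \<Rightarrow> 'a \<Rightarrow> real) \<Rightarrow> 'a \<Rightarrow> enat" where
  "num_served t \<sigma> \<omega> = Inf {enat n | n. n \<ge> 1 \<and> walk t \<sigma> n \<omega> \<le> 0}"

definition busy_period :: "(nat \<Rightarrow> 'a \<Rightarrow> real) \<Rightarrow> (nat \<Rightarrow> 'a \<Rightarrow> real) \<Rightarrow> 'a \<Rightarrow> ennreal" where
  "busy_period t \<sigma> \<omega> = (\<Sum>i. if 1 \<le> i \<and> enat i \<le> num_served t \<sigma> \<omega> then ennreal (\<sigma> i \<omega>) else 0)"

end

theory Submission
  imports Defs "HOL-Probability.Hoeffding"
begin

text \<open>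
  A long busy period is caused by a single large service time. Suppose that customer \<open>n\<close> of the
  busy period has a service time \<open>s\<close> of order \<open>x\<close>, while everything before is of order one. By
  the law of large numbers the walk, now at height about \<open>s\<close>, loses \<open>a - b\<close> per customer, so it
  returns to zero after about \<open>s / (a - b)\<close> customers, and these bring about \<open>s b / (a - b)\<close>
  units of service. The busy period thus lasts about \<open>s a / (a - b) = s / (1 - \<rho>)\<close>, which exceeds \<open>x\<close> when
  \<open>s > x (1 - \<rho>)\<close>. Whether customer \<open>n\<close> belongs to the busy period is decided before customer \<open>n\<close>
  and hence independent of \<open>\<sigma> n\<close>; summing \<open>P (\<tau> \<ge> n) P (\<sigma> n > x (1 - \<rho>))\<close> over \<open>n\<close> gives
  the formula. Intermediate regular variation makes the word \<^emph>\<open>about\<close> harmless: changing the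
  threshold by a factor close to one changes the tail by a factor close to one.

  The lower bound \<open>busy_jump_lower\<close> follows this picture literally. For the upper bound
  \<open>busy_upper\<close> other ways to a long busy period have to be excluded. If some
  service time exceeds \<open>\<epsilon> x\<close> but stays below \<open>(1 - \<rho>) x\<close> by a fixed factor, the same law of large numbers
  ends the busy period too early (\<open>busy_moderate_jump\<close>). If no service time exceeds \<open>\<epsilon> x\<close>, only the
  finite mean of the service times is at hand, and sums of truncated service times do not
  concentrate fast enough. Instead, the structure of the busy period is used recursively: it first
  accumulates more than \<open>\<epsilon> x\<close>, at which moment at most \<open>2 \<epsilon> x\<close> has been accumulated, and from then on
  it has to violate the law of large numbers. Hence (\<open>busy_no_jump\<close>)
  the probability is at most \<open>\<delta> P (B > \<epsilon> x)\<close>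
  for arbitrarily small \<open>\<delta>\<close>. Combined with the contribution of jumps above \<open>\<epsilon> x\<close> this recursion
  first shows that \<open>P (B > x)\<close> is of the order of the tail (\<open>busy_order_bound\<close>), and used
  a second time that the case without jumps is of smaller order.

  The bounds apply to the intersection of the two events of the last assertion (from below) and to each of
  them (from above) with the same constant \<open>E \<tau>\<close>, which yields all assertions together
  (\<open>ratio_limits\<close>). That \<open>E \<tau>\<close> is finite is Wald's identity for a walk with truncated inter-arrival
  times (\<open>sum_active_bounded\<close>).
\<close>

section \<open>A weak law of large numbers, uniform over index sets\<close>

text \<open>By dominated convergence. It lets a law of which only the mean exists be replaced by a bounded one.\<close>

lemma truncation_approx:
  fixes D :: "real measure"
  assumes D: "sets D = sets borel" and int: "integrable D (\<lambda>x. x)" and "\<kappa> > 0"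
  shows "\<exists>K>0. (\<integral>x. \<bar>x - (if \<bar>x\<bar> \<le> K then x else 0)\<bar> \<partial>D) \<le> \<kappa>"
proof -
  define f where "f k x = \<bar>x - (if \<bar>x\<bar> \<le> real k then x else 0)\<bar>" for k :: nat and x :: real
  have "f k \<in> borel_measurable borel" for k
    unfolding f_def by measurable
  then have [measurable]: "f k \<in> borel_measurable D" for k
    using measurable_cong_sets[OF D refl] by blast
  have "(\<lambda>k. \<integral>x. f k x \<partial>D) \<longlonglongrightarrow> (\<integral>x. 0 \<partial>D)"
  proof (rule integral_dominated_convergence)
    show "AE x in D. (\<lambda>k. f k x) \<longlonglongrightarrow> 0"
    proof (rule AE_I2)
      fix x :: real
      have "\<forall>\<^sub>F k in sequentially. f k x = 0"
        using eventually_ge_at_top[of "nat \<lceil>\<bar>x\<bar>\<rceil>"]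
      proof eventually_elim
        case (elim k)
        then have "\<bar>x\<bar> \<le> real k" by linarith
        then show ?case by (simp add: f_def)
      qed
      then show "(\<lambda>k. f k x) \<longlonglongrightarrow> 0" by (rule tendsto_eventually)
    qed
    show "integrable D (\<lambda>x. \<bar>x\<bar>)" using int by simp
  qed (auto, simp add: f_def)
  then have "\<forall>\<^sub>F k in sequentially. (\<integral>x. f k x \<partial>D) < \<kappa> \<and> k \<ge> 1"
    using \<open>\<kappa> > 0\<close> by (intro eventually_conj order_tendstoD eventually_ge_at_top) auto
  then obtain k where "(\<integral>x. f k x \<partial>D) < \<kappa>" "k \<ge> 1"
    using eventually_happens by (metis (no_types, lifting) trivial_limit_sequentially)
  then show ?thesis by (intro exI[of _ "real k"]) (auto simp: f_def)
qed

text \<open>The threshold on the number of summands depends on the common law alone, so it serves all blocks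
of consecutive customers at once, wherever they begin. Truncate the summands at a level \<open>K\<close>: the
discarded part is small in \<open>L\<^sup>1\<close> and is handled by Markov's inequality, and the bounded part
obeys Hoeffding's inequality.\<close>

lemma (in prob_space) uniform_weak_law:
  fixes X :: "nat \<Rightarrow> 'a \<Rightarrow> real" and D :: "real measure" and \<eta> \<delta> :: real
  assumes ind: "indep_vars (\<lambda>_. borel) X I"
    and D: "\<And>i. i \<in> I \<Longrightarrow> distr M borel (X i) = D"
    and int: "integrable D (\<lambda>x. x)" and \<eta>: "\<eta> > 0" and \<delta>: "\<delta> > 0"
  shows "\<exists>N. \<forall>J. finite J \<longrightarrow> J \<subseteq> I \<longrightarrow> N \<le> card J \<longrightarrow>
    prob {\<omega> \<in> space M. \<eta> * card J < \<bar>(\<Sum>i\<in>J. X i \<omega>) - card J * (\<integral>x. x \<partial>D)\<bar>} \<le> \<delta>"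
proof (cases "I = {}")
  case True
  then show ?thesis using \<delta> by (intro exI[of _ 1]) auto
next
  case False
  then obtain i0 where i0: "i0 \<in> I" by auto
  have rv[measurable]: "random_variable borel (X i)" if "i \<in> I" for i
    using ind that unfolding indep_vars_def2 by auto
  have sD[measurable_cong]: "sets D = sets borel" using D[OF i0] by auto
  interpret D: prob_space D
    using D[OF i0] rv[OF i0] by (metis prob_space_distr)
  define \<mu> where "\<mu> = (\<integral>x. x \<partial>D)"
  \<comment> \<open>The first bound absorbs the error in the mean, the second makes the Markov
      bound \<open>4 \<kappa> / \<eta>\<close> at most \<open>\<delta> / 2\<close>.\<close>
  define \<kappa> where "\<kappa> = min (\<eta>/4) (\<delta>*\<eta>/8)"
  have \<kappa>: "\<kappa> > 0" "\<kappa> \<le> \<eta>/4" "\<kappa> \<le> \<delta>*\<eta>/8" using \<eta> \<delta> by (auto simp: \<kappa>_def)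
  obtain K where K: "K > 0" "(\<integral>x. \<bar>x - (if \<bar>x\<bar> \<le> K then x else 0)\<bar> \<partial>D) \<le> \<kappa>"
    using truncation_approx[OF sD int \<kappa>(1)] by auto
  define f where "f x = (if \<bar>x\<bar> \<le> K then x else 0)" for x :: real
  have [measurable]: "f \<in> borel_measurable borel" unfolding f_def by measurable
  have fD[measurable]: "f \<in> borel_measurable D" using sD by measurable
  have f_bd: "\<bar>f x\<bar> \<le> K" "\<bar>f x\<bar> \<le> \<bar>x\<bar>" for x using K by (auto simp: f_def)
  have intf: "integrable D f"
    by (rule Bochner_Integration.integrable_bound[OF int]) (auto simp: f_bd)
  define \<mu>K where "\<mu>K = (\<integral>x. f x \<partial>D)"
  have K2: "(\<integral>x. \<bar>x - f x\<bar> \<partial>D) \<le> \<kappa>" using K(2) by (simp add: f_def)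
  have "\<bar>\<mu> - \<mu>K\<bar> = \<bar>\<integral>x. x - f x \<partial>D\<bar>" using int intf by (simp add: \<mu>_def \<mu>K_def)
  also have "\<dots> \<le> (\<integral>x. \<bar>x - f x\<bar> \<partial>D)" by (rule integral_abs_bound)
  finally have mudiff: "\<bar>\<mu> - \<mu>K\<bar> \<le> \<eta>/4" using K2 \<kappa> by linarith
  have EX: "integrable M (\<lambda>\<omega>. g (X i \<omega>))" "expectation (\<lambda>\<omega>. g (X i \<omega>)) = (\<integral>x. g x \<partial>D)"
    if "i \<in> I" "integrable D g" for i and g :: "real \<Rightarrow> real"
  proof -
    have "g \<in> borel_measurable borel" using that(2) sD by (metis borel_measurable_integrable measurable_cong_sets)
    then show "integrable M (\<lambda>\<omega>. g (X i \<omega>))" "expectation (\<lambda>\<omega>. g (X i \<omega>)) = (\<integral>x. g x \<partial>D)"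
      using integrable_distr_eq[OF rv[OF that(1)], of g] integral_distr[OF rv[OF that(1)], of g] that D[OF that(1)] by auto
  qed
  \<comment> \<open>Chosen so that the Hoeffding bound is at most \<open>2 exp (- \<bar>ln
      (\<delta> / 4)\<bar>)\<close>.\<close>
  define N where "N = Suc (nat \<lceil>8 * K\<^sup>2 / \<eta>\<^sup>2 * (\<bar>ln (\<delta>/4)\<bar>)\<rceil>)"
  show ?thesis
  proof (intro exI[of _ N] allI impI)
    fix J assume J: "finite J" "J \<subseteq> I" "N \<le> card J"
    define n where "n = real (card J)"
    have n: "n > 0" "8 * K\<^sup>2 / \<eta>\<^sup>2 * (\<bar>ln (\<delta>/4)\<bar>) \<le> n"
      using J(3) unfolding n_def N_def by linarith+
    have [measurable]: "random_variable borel (X i)" if "i \<in> J" for i using that J by auto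
    let ?A = "{\<omega> \<in> space M. n * \<eta> / 2 \<le> \<bar>(\<Sum>i\<in>J. f (X i \<omega>)) - n * \<mu>K\<bar>}"
    let ?B = "{\<omega> \<in> space M. n * \<eta> / 4 \<le> (\<Sum>i\<in>J. \<bar>X i \<omega> - f (X i \<omega>)\<bar>)}"
    have mA[measurable]: "?A \<in> sets M" and mB[measurable]: "?B \<in> sets M" by measurable
    interpret hoeffding: Hoeffding_ineq M J "\<lambda>i \<omega>. f (X i \<omega>)" "\<lambda>_. -K" "\<lambda>_. K" "\<Sum>i\<in>J. expectation (\<lambda>\<omega>. f (X i \<omega>))"
    proof unfold_locales
      show "indep_vars (\<lambda>_. borel) (\<lambda>i \<omega>. f (X i \<omega>)) J"
        by (rule indep_vars_compose2[OF indep_vars_subset[OF ind J(2)]]) auto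
      show "AE \<omega> in M. f (X i \<omega>) \<in> {- K..K}" for i
        proof (rule AE_I2)
        fix \<omega> show "f (X i \<omega>) \<in> {- K..K}" using f_bd(1)[of "X i \<omega>"] by (simp add: abs_le_iff)
      qed
    qed (use J in auto)
    have mean: "(\<Sum>i\<in>J. expectation (\<lambda>\<omega>. f (X i \<omega>))) = n * \<mu>K"
      using EX(2)[OF _ intf] J(2) by (subst sum.cong[of J J _ "\<lambda>_. \<mu>K"]) (auto simp: \<mu>K_def n_def)
    have "prob ?A \<le> 2 * exp (-2 * (n*\<eta>/2)\<^sup>2 / (n * (2*K)\<^sup>2))"
      using hoeffding.Hoeffding_ineq_abs_ge[of "n*\<eta>/2"] n K \<eta>
      by (simp add: mean n_def[symmetric])
    also have "-2 * (n*\<eta>/2)\<^sup>2 / (n * (2*K)\<^sup>2) = - (n * \<eta>\<^sup>2 / (8 * K\<^sup>2))"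
      using n K by (simp add: power2_eq_square field_simps)
    also have "\<dots> \<le> - \<bar>ln (\<delta>/4)\<bar>"
      using n(2) K \<eta> by (simp add: field_simps)
    also have "\<dots> \<le> ln (\<delta>/4)" by linarith
    finally have A: "prob ?A \<le> \<delta> / 2" using \<delta> by (simp add: exp_ln)
    have intd: "integrable D (\<lambda>x. \<bar>x - f x\<bar>)" using int intf by auto
    have "prob ?B \<le> expectation (\<lambda>\<omega>. \<Sum>i\<in>J. \<bar>X i \<omega> - f (X i \<omega>)\<bar>) / (n * \<eta> / 4)"
      by (rule integral_Markov_inequality_measure[where A="{}"])
         (use J n \<eta> EX(1)[OF _ intd] in
           \<open>auto intro!: sum_nonneg Bochner_Integration.integrable_sum simp: subset_iff simp del: integrable_abs_iff\<close>)
    also have "expectation (\<lambda>\<omega>. \<Sum>i\<in>J. \<bar>X i \<omega> - f (X i \<omega>)\<bar>) = (\<Sum>i\<in>J. (\<integral>x. \<bar>x - f x\<bar> \<partial>D))"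
      using J EX[OF _ intd]
      by (subst Bochner_Integration.integral_sum) (auto intro!: sum.cong simp: subset_iff simp del: integrable_abs_iff sum_constant)
    also have "\<dots> \<le> n * \<kappa>" using K2 n by (simp add: n_def mult_left_mono)
    also have "n * \<kappa> / (n * \<eta> / 4) = 4 * \<kappa> / \<eta>" using n by simp
    also have "\<dots> \<le> \<delta> / 2" using \<kappa>(3) \<eta> by (simp add: field_simps)
    finally have B: "prob ?B \<le> \<delta> / 2" using n \<eta> by (simp add: divide_right_mono)
    have "{\<omega> \<in> space M. \<eta> * n < \<bar>(\<Sum>i\<in>J. X i \<omega>) - n * \<mu>\<bar>} \<subseteq> ?A \<union> ?B"
    proof safe
      fix \<omega> assume \<omega>: "\<omega> \<in> space M" "\<eta> * n < \<bar>(\<Sum>i\<in>J. X i \<omega>) - n * \<mu>\<bar>"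
        "\<not> n * \<eta> / 4 \<le> (\<Sum>i\<in>J. \<bar>X i \<omega> - f (X i \<omega>)\<bar>)"
      have "(\<Sum>i\<in>J. X i \<omega>) - n * \<mu> = ((\<Sum>i\<in>J. f (X i \<omega>)) - n * \<mu>K) + (\<Sum>i\<in>J. X i \<omega> - f (X i \<omega>)) - n * (\<mu> - \<mu>K)"
        by (simp add: sum_subtractf algebra_simps)
      moreover have "\<bar>n * (\<mu> - \<mu>K)\<bar> \<le> n * \<eta> / 4"
        using mudiff n by (simp add: abs_mult)
      moreover have "\<bar>\<Sum>i\<in>J. X i \<omega> - f (X i \<omega>)\<bar> \<le> (\<Sum>i\<in>J. \<bar>X i \<omega> - f (X i \<omega>)\<bar>)" by (rule sum_abs)
      moreover have "\<bar>u + v - w\<bar> \<le> \<bar>u\<bar> + \<bar>v\<bar> + \<bar>w\<bar>" for u v w :: real by linarith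
      ultimately have "\<bar>(\<Sum>i\<in>J. X i \<omega>) - n * \<mu>\<bar> \<le> \<bar>(\<Sum>i\<in>J. f (X i \<omega>)) - n * \<mu>K\<bar>
          + (\<Sum>i\<in>J. \<bar>X i \<omega> - f (X i \<omega>)\<bar>) + n * \<eta> / 4"
        by (smt (verit))
      moreover have "\<eta> * n = n * \<eta> / 2 + n * \<eta> / 4 + n * \<eta> / 4" by simp
      ultimately show "n * \<eta> / 2 \<le> \<bar>(\<Sum>i\<in>J. f (X i \<omega>)) - n * \<mu>K\<bar>"
        using \<omega> by linarith
    qed
    then have "prob {\<omega> \<in> space M. \<eta> * n < \<bar>(\<Sum>i\<in>J. X i \<omega>) - n * \<mu>\<bar>} \<le> prob (?A \<union> ?B)"
      by (rule finite_measure_mono) auto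
    also have "\<dots> \<le> prob ?A + prob ?B" by (rule measure_Un_le) auto
    finally show "prob {\<omega> \<in> space M. \<eta> * card J < \<bar>(\<Sum>i\<in>J. X i \<omega>) - card J * (\<integral>x. x \<partial>D)\<bar>} \<le> \<delta>"
      using A B by (simp add: n_def \<mu>_def)
  qed
qed

lemma (in prob_space) tail_prob_tendsto_0:
  fixes X :: "'a \<Rightarrow> real"
  assumes [measurable]: "X \<in> borel_measurable M"
  shows "((\<lambda>y. prob {\<omega> \<in> space M. y < X \<omega>}) \<longlongrightarrow> 0) at_top"
proof -
  interpret D: real_distribution "distr M borel X" by (rule real_distribution_distr) simp
  have "cdf (distr M borel X) y = 1 - prob {\<omega> \<in> space M. y < X \<omega>}" for y
  proof -
    have "cdf (distr M borel X) y = prob (space M - {\<omega> \<in> space M. y < X \<omega>})"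
      unfolding cdf_def by (subst measure_distr) (auto intro!: arg_cong[where f=prob])
    then show ?thesis by (subst (asm) prob_compl) auto
  qed
  then have "(\<lambda>y. prob {\<omega> \<in> space M. y < X \<omega>}) = (\<lambda>y. 1 - cdf (distr M borel X) y)" by auto
  moreover have "((\<lambda>y. 1 - cdf (distr M borel X) y) \<longlongrightarrow> 1 - 1) at_top"
    by (intro tendsto_intros D.cdf_lim_at_top_prob)
  ultimately show ?thesis by simp
qed

section \<open>Intermediate regular variation and limits of ratios\<close>

text \<open>The form in which the limit enters the proofs: moving the argument by some fixed factor
\<open>\<alpha> > 1\<close> costs at most the fraction \<open>\<epsilon>\<close> of the tail.\<close>

lemma irv_ratio:
  assumes "intermediate_regularly_varying F" "\<epsilon> > 0"
  shows "\<exists>\<alpha>>1. \<forall>\<^sub>F x in at_top. (1 - \<epsilon>) * tail F x \<le> tail F (\<alpha> * x)"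
proof -
  let ?L = "\<lambda>\<alpha>. Liminf at_top (\<lambda>x. ereal (tail F (\<alpha> * x) / tail F x))"
  have pos: "\<And>x. tail F x > 0" and lim: "(?L \<longlongrightarrow> 1) (at_right 1)"
    using assms(1) by (auto simp: intermediate_regularly_varying_def)
  have "\<forall>\<^sub>F \<alpha> in at_right (1::real). ereal (1 - \<epsilon>) < ?L \<alpha> \<and> 1 < \<alpha>"
    using assms(2) by (intro eventually_conj order_tendstoD(1)[OF lim] eventually_at_right_less) (simp add: one_ereal_def)
  then obtain \<alpha> where \<alpha>: "1 < \<alpha>" "ereal (1 - \<epsilon>) < ?L \<alpha>"
    using eventually_happens[of _ "at_right (1::real)"] by (auto simp: trivial_limit_at_right_real)
  have "\<forall>\<^sub>F x in at_top. ereal (1 - \<epsilon>) < ereal (tail F (\<alpha> * x) / tail F x)"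
    by (rule less_LiminfD[OF \<alpha>(2)])
  then have "\<forall>\<^sub>F x in at_top. (1 - \<epsilon>) * tail F x \<le> tail F (\<alpha> * x)"
  proof eventually_elim
    case (elim x)
    then have "1 - \<epsilon> < tail F (\<alpha> * x) / tail F x" by simp
    then show ?case using pos[of x] by (subst (asm) pos_less_divide_eq) auto
  qed
  then show ?thesis using \<alpha>(1) by blast
qed

lemma eventually_scale:
  assumes "eventually P at_top" "0 < (c::real)"
  shows "\<forall>\<^sub>F x in at_top. P (c * x)"
  using filterlim_tendsto_pos_mult_at_top[OF tendsto_const assms(2) filterlim_ident] assms(1)
  by (auto simp: filterlim_iff)

lemma tendsto_of_eventual_bounds:
  fixes f :: "'b \<Rightarrow> real"
  assumes "\<And>\<delta>. \<delta> > 0 \<Longrightarrow> \<forall>\<^sub>F x in F. l - \<delta> \<le> f x" "\<And>\<delta>. \<delta> > 0 \<Longrightarrow> \<forall>\<^sub>F x in F. f x \<le> l + \<delta>"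
  shows "(f \<longlongrightarrow> l) F"
proof (rule order_tendstoI)
  fix c assume "c < l"
  then show "\<forall>\<^sub>F x in F. c < f x"
    using assms(1)[of "(l - c) / 2"] by (auto elim!: eventually_mono simp: field_simps)
next
  fix c assume "l < c"
  then show "\<forall>\<^sub>F x in F. f x < c"
    using assms(2)[of "(c - l) / 2"] by (auto elim!: eventually_mono simp: field_simps)
qed

lemma asymp_ge_of_limits:
  fixes f g h :: "real \<Rightarrow> real"
  assumes f: "((\<lambda>x. f x / h x) \<longlongrightarrow> l) at_top" and g: "((\<lambda>x. g x / h x) \<longlongrightarrow> m) at_top"
    and h: "\<And>x. h x \<noteq> 0" and m: "0 < m" "m \<le> l"
  shows "f \<greatersim> g"
proof -
  have "((\<lambda>x. (f x / h x) / (g x / h x)) \<longlongrightarrow> l / m) at_top"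
    using m by (intro tendsto_divide f g) auto
  then have "((\<lambda>x. ereal (f x / g x)) \<longlongrightarrow> ereal (l / m)) at_top" using h by simp
  then have "Liminf at_top (\<lambda>x. ereal (f x / g x)) = ereal (l / m)"
    by (intro lim_imp_Liminf) auto
  then show ?thesis using m by (simp add: asymp_ge_def)
qed

section \<open>Paths of the queue\<close>

definition work :: "(nat \<Rightarrow> 'a \<Rightarrow> real) \<Rightarrow> nat \<Rightarrow> 'a \<Rightarrow> real" where
  "work \<sigma> n \<omega> = (\<Sum>i=1..n. \<sigma> i \<omega>)"

lemma walk_eq_work: "walk t \<sigma> n \<omega> = work \<sigma> n \<omega> - work t n \<omega>"
  by (simp add: walk_def work_def sum_subtractf)

lemma work_add: "work \<sigma> (n + m) \<omega> = work \<sigma> n \<omega> + (\<Sum>i\<in>{n<..n+m}. \<sigma> i \<omega>)"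
proof -
  have "{1..n+m} = {1..n} \<union> {n<..n+m}" by auto
  then show ?thesis unfolding work_def by (simp add: sum.union_disjoint ivl_disj_int)
qed

lemma work_Suc: "work \<sigma> (Suc n) \<omega> = work \<sigma> n \<omega> + \<sigma> (Suc n) \<omega>"
  by (simp add: work_def)

lemma work_mono:
  assumes "\<forall>i\<ge>1. 0 \<le> \<sigma> i \<omega>" "m \<le> n"
  shows "work \<sigma> m \<omega> \<le> work \<sigma> n \<omega>"
  unfolding work_def using assms by (intro sum_mono2) auto

lemma num_served_ge_iff:
  "enat n \<le> num_served t \<sigma> \<omega> \<longleftrightarrow> (\<forall>k\<in>{1..<n}. 0 < walk t \<sigma> k \<omega>)"
proof -
  have "enat n \<le> num_served t \<sigma> \<omega> \<longleftrightarrow> (\<forall>m\<ge>1. walk t \<sigma> m \<omega> \<le> 0 \<longrightarrow> n \<le> m)"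
    unfolding num_served_def le_Inf_iff by auto
  also have "\<dots> \<longleftrightarrow> (\<forall>k\<in>{1..<n}. 0 < walk t \<sigma> k \<omega>)"
    by (auto simp: not_le[symmetric])
  finally show ?thesis .
qed

text \<open>The partial sums of the series defining the busy period are the accumulated services of the
customers served so far. From here on all path arguments are about finite real sums.\<close>

lemma busy_period_gt_iff:
  assumes nn: "\<forall>i\<ge>1. 0 \<le> \<sigma> i \<omega>" and x: "0 \<le> x"
  shows "ennreal x < busy_period t \<sigma> \<omega> \<longleftrightarrow>
    (\<exists>n\<ge>1. enat n \<le> num_served t \<sigma> \<omega> \<and> x < work \<sigma> n \<omega>)"
proof -
  define c where "c i = (if 1 \<le> i \<and> enat i \<le> num_served t \<sigma> \<omega> then ennreal (\<sigma> i \<omega>) else 0)" for i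
  have work_nn: "0 \<le> work \<sigma> n \<omega>" for n
    unfolding work_def using nn by (intro sum_nonneg) auto
  have part: "(\<Sum>i<Suc n. c i) = ennreal (work \<sigma> n \<omega>)" if "enat n \<le> num_served t \<sigma> \<omega>" for n
  proof -
    have "enat i \<le> num_served t \<sigma> \<omega>" if "i \<le> n" for i
      using that \<open>enat n \<le> num_served t \<sigma> \<omega>\<close> by (meson enat_ord_simps(1) order_trans)
    then have "(\<Sum>i<Suc n. c i) = (\<Sum>i=1..n. ennreal (\<sigma> i \<omega>))"
      by (intro sum.mono_neutral_cong_right) (auto simp: c_def less_Suc_eq_le)
    also have "\<dots> = ennreal (work \<sigma> n \<omega>)" unfolding work_def using nn by (subst sum_ennreal) auto
    finally show ?thesis .
  qed
  have part': "\<exists>n. (n = 0 \<or> enat n \<le> num_served t \<sigma> \<omega>) \<and> (\<Sum>i<m. c i) = ennreal (work \<sigma> n \<omega>)" for m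
  proof (induction m)
    case 0
    show ?case by (intro exI[of _ 0]) (simp add: work_def)
  next
    case (Suc m)
    show ?case
    proof (cases "1 \<le> m \<and> enat m \<le> num_served t \<sigma> \<omega>")
      case True
      then show ?thesis using part[of m] by blast
    next
      case False
      then have "c m = 0" unfolding c_def by (rule if_not_P)
      then show ?thesis using Suc by simp
    qed
  qed
  have "ennreal x < busy_period t \<sigma> \<omega> \<longleftrightarrow> (\<exists>m. ennreal x < (\<Sum>i<m. c i))"
    unfolding busy_period_def c_def[symmetric] suminf_eq_SUP less_SUP_iff by simp
  also have "\<dots> \<longleftrightarrow> (\<exists>n\<ge>1. enat n \<le> num_served t \<sigma> \<omega> \<and> x < work \<sigma> n \<omega>)"
  proof (intro iffI; elim exE conjE)
    fix m assume m: "ennreal x < (\<Sum>i<m. c i)"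
    obtain n where n: "n = 0 \<or> enat n \<le> num_served t \<sigma> \<omega>" "(\<Sum>i<m. c i) = ennreal (work \<sigma> n \<omega>)"
      using part'[of m] by blast
    with m x have "x < work \<sigma> n \<omega>" by (simp add: ennreal_less_iff)
    moreover from this x have "n \<noteq> 0" by (auto simp: work_def intro: ccontr)
    ultimately show "\<exists>n\<ge>1. enat n \<le> num_served t \<sigma> \<omega> \<and> x < work \<sigma> n \<omega>"
      using n(1) by (intro exI[of _ n]) auto
  next
    fix n assume "1 \<le> n" "enat n \<le> num_served t \<sigma> \<omega>" "x < work \<sigma> n \<omega>"
    then show "\<exists>m. ennreal x < (\<Sum>i<m. c i)"
      using part[of n] x by (intro exI[of _ "Suc n"]) (simp add: ennreal_less_iff)
  qed
  finally show ?thesis .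
qed

section \<open>Independence of disjoint groups of service and inter-arrival times\<close>

definition preimages :: "'a measure \<Rightarrow> (nat \<Rightarrow> 'a \<Rightarrow> real) \<Rightarrow> nat \<Rightarrow> 'a set set" where
  "preimages M X i = {X i -` A \<inter> space M | A. A \<in> sets borel}"

context gi_gi_1_queue
begin

text \<open>The information in the service times with indices in \<open>K\<close> and the inter-arrival times with
indices in \<open>L\<close>. Two index sets are kept because the event that customer \<open>n\<close> belongs to the busy
period, the service time of customer \<open>n\<close>, and \<open>t n\<close> with everything later have to be
separated from one another.\<close>

definition info :: "nat set \<Rightarrow> nat set \<Rightarrow> 'a measure" where
  "info K L = sigma (space M) (\<Union> (preimages M \<sigma> ` K) \<union> \<Union> (preimages M t ` L))"

lemma rv_\<sigma>[measurable]: "i \<ge> 1 \<Longrightarrow> \<sigma> i \<in> borel_measurable M"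
  using indep_\<sigma> unfolding indep_vars_def2 by auto

lemma rv_t[measurable]: "i \<ge> 1 \<Longrightarrow> t i \<in> borel_measurable M"
  using indep_t unfolding indep_vars_def2 by auto

lemma space_info[simp]: "space (info K L) = space M"
  by (simp add: info_def space_measure_of_conv)

lemma sets_info:
  "sets (info K L) = sigma_sets (space M) (\<Union> (preimages M \<sigma> ` K) \<union> \<Union> (preimages M t ` L))"
  unfolding info_def by (rule sets_measure_of) (auto simp: preimages_def)

lemma info_\<sigma>: "i \<in> K \<Longrightarrow> \<sigma> i \<in> borel_measurable (info K L)"
  by (rule measurableI) (auto simp: sets_info preimages_def intro!: sigma_sets.Basic)

lemma info_t: "i \<in> L \<Longrightarrow> t i \<in> borel_measurable (info K L)"
  by (rule measurableI) (auto simp: sets_info preimages_def intro!: sigma_sets.Basic)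

lemma sets_info_subset: "K \<subseteq> {1..} \<Longrightarrow> L \<subseteq> {1..} \<Longrightarrow> sets (info K L) \<subseteq> sets M"
  unfolding sets_info
  by (rule sets.sigma_sets_subset) (auto simp: preimages_def subset_iff intro!: measurable_sets)

lemma info_mono:
  assumes "K \<subseteq> K'" "L \<subseteq> L'"
  shows "sets (info K L) \<subseteq> sets (info K' L')"
  unfolding sets_info using assms by (intro sigma_sets_mono') (auto; blast)

text \<open>The two sequences are independent of each other, and each is an independent sequence. Over the
disjoint union of the index sets these hypotheses merge into one independent family, to which the
grouping theorem for independent families applies.\<close>

lemma indep_joint:
  "indep_sets (case_sum (preimages M \<sigma>) (preimages M t)) ({1..} <+> {1..})"
proof (rule indep_setsI)
  show "case_sum (preimages M \<sigma>) (preimages M t) i \<subseteq> events" if "i \<in> {1..} <+> {1..}" for i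
    using that by (auto simp: preimages_def)
next
  fix A :: "nat + nat \<Rightarrow> 'a set" and J :: "(nat + nat) set"
  assume J: "J \<noteq> {}" "J \<subseteq> {1..} <+> {1..}" "finite J"
    "\<forall>j\<in>J. A j \<in> case_sum (preimages M \<sigma>) (preimages M t) j"
  define J1 where "J1 = {i. Inl i \<in> J}"
  define J2 where "J2 = {i. Inr i \<in> J}"
  have J12: "J = Inl ` J1 \<union> Inr ` J2"
  proof (rule set_eqI)
    fix j show "j \<in> J \<longleftrightarrow> j \<in> Inl ` J1 \<union> Inr ` J2"
      by (cases j) (auto simp: J1_def J2_def)
  qed
  have fin: "finite J1" "finite J2"
    using finite_vimageI[OF J(3), of Inl] finite_vimageI[OF J(3), of Inr]
    by (auto simp: J1_def J2_def vimage_def)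
  have sub: "J1 \<subseteq> {1..}" "J2 \<subseteq> {1..}" using J(2) by (auto simp: J1_def J2_def)
  have AJ: "A (Inl i) \<in> preimages M \<sigma> i" if "i \<in> J1" for i
    using J(4)[rule_format, of "Inl i"] that by (simp add: J1_def)
  have AJ': "A (Inr i) \<in> preimages M t i" if "i \<in> J2" for i
    using J(4)[rule_format, of "Inr i"] that by (simp add: J2_def)
  have "\<exists>S. \<forall>i\<in>J1. S i \<in> sets borel \<and> A (Inl i) = \<sigma> i -` S i \<inter> space M"
    using AJ unfolding preimages_def by (intro bchoice ballI) blast
  then obtain S where S: "\<And>i. i \<in> J1 \<Longrightarrow> S i \<in> sets borel"
    "\<And>i. i \<in> J1 \<Longrightarrow> A (Inl i) = \<sigma> i -` S i \<inter> space M" by blast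
  have "\<exists>S. \<forall>i\<in>J2. S i \<in> sets borel \<and> A (Inr i) = t i -` S i \<inter> space M"
    using AJ' unfolding preimages_def by (intro bchoice ballI) blast
  then obtain T where T: "\<And>i. i \<in> J2 \<Longrightarrow> T i \<in> sets borel"
    "\<And>i. i \<in> J2 \<Longrightarrow> A (Inr i) = t i -` T i \<inter> space M" by blast
  define SS where "SS = {f \<in> space (PiM {1..} (\<lambda>_. borel::real measure)). \<forall>i\<in>J1. f i \<in> S i}"
  define TT where "TT = {f \<in> space (PiM {1..} (\<lambda>_. borel::real measure)). \<forall>i\<in>J2. f i \<in> T i}"
  have sets: "SS \<in> sets (PiM {1..} (\<lambda>_. borel))" "TT \<in> sets (PiM {1..} (\<lambda>_. borel))"
  proof -
    have "{f \<in> space (PiM {1..} (\<lambda>_. borel::real measure)). f i \<in> U} \<in> sets (PiM {1..} (\<lambda>_. borel))"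
      if "i \<in> {1..}" "U \<in> sets borel" for i :: nat and U
      using measurable_sets[OF measurable_component_singleton[OF that(1)] that(2)]
      by (simp add: vimage_def Int_def conj_commute)
    then show "SS \<in> sets (PiM {1..} (\<lambda>_. borel))" "TT \<in> sets (PiM {1..} (\<lambda>_. borel))"
      unfolding SS_def TT_def using S(1) T(1) sub fin by (auto intro!: sets.sets_Collect_finite_All)
  qed
  have 1: "(\<lambda>\<omega>. \<lambda>i\<in>{1..}. \<sigma> i \<omega>) -` SS \<inter> space M = {\<omega>\<in>space M. \<forall>i\<in>J1. \<omega> \<in> A (Inl i)}"
    using S(2) sub by (auto simp: SS_def space_PiM)
  have 2: "(\<lambda>\<omega>. \<lambda>i\<in>{1..}. t i \<omega>) -` TT \<inter> space M = {\<omega>\<in>space M. \<forall>i\<in>J2. \<omega> \<in> A (Inr i)}"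
    using T(2) sub by (auto simp: TT_def space_PiM)
  have "(\<Inter>j\<in>J. A j) = {\<omega>\<in>space M. \<forall>i\<in>J2. \<omega> \<in> A (Inr i)} \<inter> {\<omega>\<in>space M. \<forall>i\<in>J1. \<omega> \<in> A (Inl i)}"
  proof -
    have "A j \<subseteq> space M" if "j \<in> J" for j
      using that S(2) T(2) unfolding J12 by auto
    then have "(\<Inter>j\<in>J. A j) = {\<omega>\<in>space M. \<forall>j\<in>J. \<omega> \<in> A j}" using J(1) by blast
    then show ?thesis unfolding J12 by auto
  qed
  also have "\<dots> = (\<lambda>\<omega>. ((\<lambda>i\<in>{1..}. t i \<omega>), (\<lambda>i\<in>{1..}. \<sigma> i \<omega>))) -` (TT \<times> SS) \<inter> space M"
    using 1 2 by blast
  also have "prob \<dots> = prob {\<omega>\<in>space M. \<forall>i\<in>J2. \<omega> \<in> A (Inr i)} * prob {\<omega>\<in>space M. \<forall>i\<in>J1. \<omega> \<in> A (Inl i)}"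
    using indep_varD[OF indep_t_\<sigma> sets(2,1)] by (simp only: 1 2)
  also have "prob {\<omega>\<in>space M. \<forall>i\<in>J1. \<omega> \<in> A (Inl i)} = (\<Prod>i\<in>J1. prob (A (Inl i)))"
  proof (cases "J1 = {}")
    case False
    then have "{\<omega>\<in>space M. \<forall>i\<in>J1. \<omega> \<in> A (Inl i)} = (\<Inter>i\<in>J1. \<sigma> i -` S i \<inter> space M)" using S(2) by auto
    then show ?thesis using indep_varsD[OF indep_\<sigma> False fin(1) sub(1), of S] S by simp
  qed (simp add: prob_space)
  also have "prob {\<omega>\<in>space M. \<forall>i\<in>J2. \<omega> \<in> A (Inr i)} = (\<Prod>i\<in>J2. prob (A (Inr i)))"
  proof (cases "J2 = {}")
    case False
    then have "{\<omega>\<in>space M. \<forall>i\<in>J2. \<omega> \<in> A (Inr i)} = (\<Inter>i\<in>J2. t i -` T i \<inter> space M)" using T(2) by auto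
    then show ?thesis using indep_varsD[OF indep_t False fin(2) sub(2), of T] T by simp
  qed (simp add: prob_space)
  finally show "prob (\<Inter>j\<in>J. A j) = (\<Prod>j\<in>J. prob (A j))"
    unfolding J12 using fin by (subst prod.union_disjoint) (auto simp: prod.reindex inj_on_def)
qed

lemma info_indep:
  assumes "A \<in> sets (info K L)" "A' \<in> sets (info K' L')"
    and sub: "K \<subseteq> {1..}" "L \<subseteq> {1..}" "K' \<subseteq> {1..}" "L' \<subseteq> {1..}"
    and disj: "K \<inter> K' = {}" "L \<inter> L' = {}"
  shows "prob (A \<inter> A') = prob A * prob A'"
proof -
  let ?E = "case_sum (preimages M \<sigma>) (preimages M t)"
  define I where "I b = (if b then K <+> L else K' <+> L')" for b
  have "indep_sets (\<lambda>j. sigma_sets (space M) (\<Union>i\<in>I j. ?E i)) (UNIV :: bool set)"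
  proof (rule indep_sets_collect_sigma)
    show "indep_sets ?E (\<Union>j\<in>UNIV. I j)"
      by (rule indep_sets_mono_index[OF _ indep_joint]) (use sub in \<open>auto simp: I_def subset_iff split: if_splits\<close>)
    show "Int_stable (?E i)" for i
    proof (rule Int_stableI)
      fix a b assume *: "a \<in> ?E i" "b \<in> ?E i"
      have "\<exists>X. ?E i = {X -` A \<inter> space M | A. A \<in> sets (borel :: real measure)}"
        by (cases i) (auto simp: preimages_def)
      then obtain X where X: "?E i = {X -` A \<inter> space M | A. A \<in> sets (borel :: real measure)}" by blast
      from * obtain A B where "a = X -` A \<inter> space M" "b = X -` B \<inter> space M" "A \<in> sets borel" "B \<in> sets borel"
        unfolding X by auto
      then show "a \<inter> b \<in> ?E i" unfolding X by (intro CollectI exI[of _ "A \<inter> B"]) auto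
    qed
    show "disjoint_family_on I UNIV"
      using disj by (auto simp: disjoint_family_on_def I_def)
  qed
  moreover have "(\<Union>i\<in>K1 <+> L1. ?E i) = \<Union> (preimages M \<sigma> ` K1) \<union> \<Union> (preimages M t ` L1)" for K1 L1
    by (auto simp: Plus_def)
  ultimately have "indep_sets (\<lambda>b. if b then sets (info K L) else sets (info K' L')) UNIV"
    unfolding sets_info by (subst indep_sets_cong[OF refl]) (auto simp: I_def)
  then show ?thesis
    using indep_setsD[of "\<lambda>b. if b then sets (info K L) else sets (info K' L')" UNIV UNIV "\<lambda>b. if b then A else A'"] assms(1,2)
    by (simp add: UNIV_bool Int_commute mult.commute)
qed

lemma indep_var_info:
  assumes X: "X \<in> borel_measurable (info K L)" and Y: "Y \<in> borel_measurable (info K' L')"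
    and sub: "K \<subseteq> {1..}" "L \<subseteq> {1..}" "K' \<subseteq> {1..}" "L' \<subseteq> {1..}"
    and disj: "K \<inter> K' = {}" "L \<inter> L' = {}"
  shows "indep_var borel X borel Y"
proof -
  have gen: "sigma_sets (space M) {Z -` A \<inter> space M | A. A \<in> sets borel} \<subseteq> sets (info I J)"
    if Z: "Z \<in> borel_measurable (info I J)" for Z :: "'a \<Rightarrow> 'c::topological_space" and I J
  proof -
    have "{Z -` A \<inter> space M | A. A \<in> sets borel} \<subseteq> sets (info I J)"
      using measurable_sets[OF Z] by auto
    from sets.sigma_sets_subset[OF this] show ?thesis by simp
  qed
  have M: "Z \<in> borel_measurable M" if "Z \<in> borel_measurable (info I J)" "I \<subseteq> {1..}" "J \<subseteq> {1..}"
    for Z :: "'a \<Rightarrow> 'c::topological_space" and I J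
    using measurable_sets[OF that(1)] sets_info_subset[OF that(2,3)]
    by (intro measurableI) auto
  show ?thesis unfolding indep_var_eq
  proof (intro conjI indep_setI)
    show "random_variable borel X" "random_variable borel Y" using M[OF X] M[OF Y] sub by auto
  next
    show "sigma_sets (space M) {X -` A \<inter> space M | A. A \<in> sets borel} \<subseteq> events"
      using gen[OF X] sets_info_subset[OF sub(1,2)] by blast
    show "sigma_sets (space M) {Y -` A \<inter> space M | A. A \<in> sets borel} \<subseteq> events"
      using gen[OF Y] sets_info_subset[OF sub(3,4)] by blast
  next
    fix A C assume "A \<in> sigma_sets (space M) {X -` A \<inter> space M | A. A \<in> sets borel}"
      "C \<in> sigma_sets (space M) {Y -` A \<inter> space M | A. A \<in> sets borel}"
    then have "A \<in> sets (info K L)" "C \<in> sets (info K' L')" using gen[OF X] gen[OF Y] by auto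
    then show "prob (A \<inter> C) = prob A * prob C" using info_indep sub disj by blast
  qed
qed

section \<open>Customers of the busy period and failures of the law of large numbers\<close>

lemma tail_eq: "n \<ge> 1 \<Longrightarrow> prob {\<omega> \<in> space M. y < \<sigma> n \<omega>} = tail H y"
proof -
  assume n: "n \<ge> 1"
  note [measurable] = rv_\<sigma>[OF n]
  have "cdf H y = prob {\<omega> \<in> space M. \<sigma> n \<omega> \<le> y}"
    unfolding cdf_def distr_\<sigma>[OF n, symmetric]
    by (subst measure_distr) (auto intro!: arg_cong[where f=prob])
  also have "\<dots> = 1 - prob (space M - {\<omega> \<in> space M. \<sigma> n \<omega> \<le> y})"
    by (subst prob_compl) auto
  also have "space M - {\<omega> \<in> space M. \<sigma> n \<omega> \<le> y} = {\<omega> \<in> space M. y < \<sigma> n \<omega>}" by auto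
  finally show ?thesis by (simp add: tail_def)
qed

lemma tail_antimono: "x \<le> y \<Longrightarrow> tail H y \<le> tail H x"
  unfolding tail_eq[of 1, symmetric, simplified] by (intro finite_measure_mono) auto

lemma tail_nonneg: "0 \<le> tail H x"
  unfolding tail_eq[of 1, symmetric, simplified] by auto

lemma tail_tendsto_0: "(tail H \<longlongrightarrow> 0) at_top"
proof -
  have "(\<lambda>y. prob {\<omega> \<in> space M. y < \<sigma> 1 \<omega>}) = tail H"
    by (rule ext) (rule tail_eq, simp)
  then show ?thesis using tail_prob_tendsto_0[OF rv_\<sigma>[of 1]] by simp
qed

lemma integrable_\<sigma>: "n \<ge> 1 \<Longrightarrow> integrable M (\<sigma> n)"
proof -
  assume n: "n \<ge> 1"
  have "integrable (distr M borel (\<sigma> n)) (\<lambda>x. x)"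
    unfolding distr_\<sigma>[OF n] by (rule integrable_H)
  then show ?thesis using n by (subst (asm) integrable_distr_eq) simp_all
qed

lemma mean_\<sigma>: "n \<ge> 1 \<Longrightarrow> expectation (\<sigma> n) = b"
proof -
  assume n: "n \<ge> 1"
  have "(\<integral>x. x \<partial>distr M borel (\<sigma> n)) = b"
    unfolding distr_\<sigma>[OF n] by (rule mean_H)
  then show ?thesis using n by (subst (asm) integral_distr) simp_all
qed

text \<open>Nonnegativity is only given almost surely, and monotonicity of the accumulated times needs it on
the path itself.\<close>

definition regular :: "'a \<Rightarrow> bool" where
  "regular \<omega> \<longleftrightarrow> (\<forall>i\<ge>1. 0 \<le> \<sigma> i \<omega>) \<and> (\<forall>i\<ge>1. 0 \<le> t i \<omega>)"

lemma AE_regular: "AE \<omega> in M. regular \<omega>"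
  unfolding regular_def using nonneg_\<sigma> nonneg_t by (simp add: AE_all_countable)

lemma prob_mono_regular:
  assumes "\<And>\<omega>. \<omega> \<in> space M \<Longrightarrow> regular \<omega> \<Longrightarrow> \<omega> \<in> A \<Longrightarrow> \<omega> \<in> C" "C \<in> events"
  shows "prob A \<le> prob C"
  using AE_regular AE_space assms by (intro finite_measure_mono_AE) (auto elim!: AE_mp)

text \<open>Whether customer \<open>n\<close> belongs to the first busy period is decided by the customers before \<open>n\<close>,
hence independent of \<open>\<sigma> n\<close>. So the service time of \<open>n\<close> enters all estimates as a factor.\<close>

definition active :: "nat \<Rightarrow> 'a set" where
  "active n = {\<omega> \<in> space M. enat n \<le> num_served t \<sigma> \<omega>}"

abbreviation busy :: "real \<Rightarrow> 'a set" where
  "busy x \<equiv> {\<omega> \<in> space M. ennreal x < busy_period t \<sigma> \<omega>}"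

lemma active_info: "{1..<n} \<subseteq> K \<Longrightarrow> {1..<n} \<subseteq> L \<Longrightarrow> active n \<in> sets (info K L)"
proof -
  assume KL: "{1..<n} \<subseteq> K" "{1..<n} \<subseteq> L"
  have "active n = {\<omega> \<in> space (info K L). \<forall>k\<in>{1..<n}. 0 < walk t \<sigma> k \<omega>}"
    by (simp add: active_def num_served_ge_iff)
  moreover have "walk t \<sigma> k \<in> borel_measurable (info K L)" if "k < n" for k
    unfolding walk_def using that KL
    by (intro borel_measurable_sum borel_measurable_diff info_\<sigma> info_t) auto
  then have "{\<omega> \<in> space (info K L). 0 < walk t \<sigma> k \<omega>} \<in> sets (info K L)" if "k \<in> {1..<n}" for k
    using that by (intro borel_measurable_less borel_measurable_const) auto
  ultimately show ?thesis by (simp only: sets.sets_Collect_finite_All finite_atLeastLessThan)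
qed

lemma active_events[measurable]: "active n \<in> events"
proof -
  have "{1..<n} \<subseteq> {1..}" by auto
  then show ?thesis using active_info sets_info_subset by blast
qed

lemma active_1: "n \<le> 1 \<Longrightarrow> active n = space M"
  by (auto simp: active_def num_served_ge_iff)

lemma active_antimono: "m \<le> n \<Longrightarrow> active n \<subseteq> active m"
  by (auto simp: active_def num_served_ge_iff)

lemma work_info:
  "{1..n} \<subseteq> K \<Longrightarrow> work \<sigma> n \<in> borel_measurable (info K L)"
  unfolding work_def[abs_def] by (intro borel_measurable_sum info_\<sigma>) auto

lemma work_measurable[measurable]: "work \<sigma> n \<in> borel_measurable M"
  unfolding work_def[abs_def] by (intro borel_measurable_sum rv_\<sigma>) auto

lemma busy_events[measurable]: "busy x \<in> events"
proof -
  have [measurable]: "Measurable.pred M (\<lambda>\<omega>. enat i \<le> num_served t \<sigma> \<omega>)" for i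
    using active_events[of i] unfolding active_def by (simp add: pred_def)
  have "(\<lambda>\<omega>. if 1 \<le> i \<and> enat i \<le> num_served t \<sigma> \<omega> then ennreal (\<sigma> i \<omega>) else 0) \<in> borel_measurable M" for i
    by (cases "1 \<le> i") auto
  then have "busy_period t \<sigma> \<in> borel_measurable M"
    unfolding busy_period_def[abs_def] by simp
  then show ?thesis by measurable
qed

lemma busy_iff:
  "regular \<omega> \<Longrightarrow> \<omega> \<in> space M \<Longrightarrow> 0 \<le> x \<Longrightarrow> \<omega> \<in> busy x \<longleftrightarrow> (\<exists>n\<ge>1. \<omega> \<in> active n \<and> x < work \<sigma> n \<omega>)"
  using busy_period_gt_iff[of \<sigma> \<omega> x t] by (auto simp: regular_def active_def)

text \<open>The law of large numbers fails, with relative tolerance \<open>\<eta>\<close>, on the block of the \<open>m\<close> customers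
that follow customer \<open>n\<close>.\<close>

definition deviates :: "real \<Rightarrow> nat \<Rightarrow> nat \<Rightarrow> 'a set" where
  "deviates \<eta> n m = {\<omega> \<in> space M.
     \<eta> * m < \<bar>(\<Sum>i\<in>{n<..n+m}. \<sigma> i \<omega>) - m * b\<bar> \<or> \<eta> * m < \<bar>(\<Sum>i\<in>{n<..n+m}. t i \<omega>) - m * a\<bar>}"

lemma deviates_info: "deviates \<eta> n m \<in> sets (info {n<..} {n<..})"
proof -
  have [measurable]: "(\<lambda>\<omega>. \<Sum>i\<in>{n<..n+m}. \<sigma> i \<omega>) \<in> borel_measurable (info {n<..} {n<..})"
    "(\<lambda>\<omega>. \<Sum>i\<in>{n<..n+m}. t i \<omega>) \<in> borel_measurable (info {n<..} {n<..})"
    by (intro borel_measurable_sum info_\<sigma> info_t; auto)+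
  show ?thesis unfolding deviates_def space_info[of "{n<..}" "{n<..}", symmetric] by measurable
qed

lemma deviates_events[measurable]: "deviates \<eta> n m \<in> events"
proof -
  have "{n<..} \<subseteq> {1..}" by auto
  then show ?thesis using deviates_info sets_info_subset by blast
qed

lemma deviates_small:
  assumes "\<eta> > 0" "\<delta> > 0"
  shows "\<exists>N. \<forall>m\<ge>N. \<forall>n. prob (deviates \<eta> n m) \<le> \<delta>"
proof -
  have t_D: "integrable (distr M borel (t 1)) (\<lambda>x. x)" "(\<integral>x. x \<partial>distr M borel (t 1)) = a"
    using integrable_t mean_t by (simp_all add: integrable_distr_eq integral_distr)
  obtain N1 where N1: "\<And>J. finite J \<Longrightarrow> J \<subseteq> {1..} \<Longrightarrow> N1 \<le> card J \<Longrightarrow>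
      prob {\<omega> \<in> space M. \<eta> * card J < \<bar>(\<Sum>i\<in>J. \<sigma> i \<omega>) - card J * b\<bar>} \<le> \<delta>/2"
    using uniform_weak_law[OF indep_\<sigma> distr_\<sigma> integrable_H assms(1), of "\<delta>/2"] assms(2)
    unfolding mean_H by auto
  obtain N2 where N2: "\<And>J. finite J \<Longrightarrow> J \<subseteq> {1..} \<Longrightarrow> N2 \<le> card J \<Longrightarrow>
      prob {\<omega> \<in> space M. \<eta> * card J < \<bar>(\<Sum>i\<in>J. t i \<omega>) - card J * a\<bar>} \<le> \<delta>/2"
    using uniform_weak_law[OF indep_t ident_t t_D(1) assms(1), of "\<delta>/2"] assms(2)
    unfolding t_D(2) by auto
  show ?thesis
  proof (intro exI[of _ "max N1 N2"] allI impI)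
    fix m n assume m: "max N1 N2 \<le> m"
    let ?J = "{n<..n+m}"
    have [measurable]: "(\<lambda>\<omega>. \<Sum>i\<in>?J. \<sigma> i \<omega>) \<in> borel_measurable M" "(\<lambda>\<omega>. \<Sum>i\<in>?J. t i \<omega>) \<in> borel_measurable M"
      by (intro borel_measurable_sum rv_\<sigma> rv_t; auto)+
    have "prob (deviates \<eta> n m) \<le>
      prob ({\<omega> \<in> space M. \<eta> * m < \<bar>(\<Sum>i\<in>?J. \<sigma> i \<omega>) - m * b\<bar>} \<union>
            {\<omega> \<in> space M. \<eta> * m < \<bar>(\<Sum>i\<in>?J. t i \<omega>) - m * a\<bar>})"
      by (rule finite_measure_mono) (auto simp: deviates_def)
    also have "\<dots> \<le> prob {\<omega> \<in> space M. \<eta> * m < \<bar>(\<Sum>i\<in>?J. \<sigma> i \<omega>) - m * b\<bar>}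
      + prob {\<omega> \<in> space M. \<eta> * m < \<bar>(\<Sum>i\<in>?J. t i \<omega>) - m * a\<bar>}"
      by (rule measure_Un_le) auto
    also have "\<dots> \<le> \<delta>/2 + \<delta>/2"
      using N1[of ?J] N2[of ?J] m by (intro add_mono) (auto simp: subset_iff)
    finally show "prob (deviates \<eta> n m) \<le> \<delta>" by simp
  qed
qed

lemma past_future_indep:
  assumes "A \<in> sets (info {1..n} {1..n})" "C \<in> sets (info {n<..} {n<..})"
  shows "prob (A \<inter> C) = prob A * prob C"
  by (rule info_indep[OF assms]) auto

lemma active_jump_indep:
  assumes "n \<ge> 1" "S \<in> sets borel"
  shows "prob (active n \<inter> {\<omega> \<in> space M. \<sigma> n \<omega> \<in> S}) = prob (active n) * prob {\<omega> \<in> space M. \<sigma> n \<omega> \<in> S}"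
proof (rule info_indep)
  show "active n \<in> sets (info {1..<n} {1..<n})" by (rule active_info) auto
  have "\<sigma> n \<in> borel_measurable (info {n} {})" by (rule info_\<sigma>) auto
  from measurable_sets[OF this assms(2)]
  show "{\<omega> \<in> space M. \<sigma> n \<omega> \<in> S} \<in> sets (info {n} {})" by (simp add: vimage_def Int_def conj_commute)
qed (use assms in auto)

lemma active_jump: "n \<ge> 1 \<Longrightarrow> prob {\<omega> \<in> active n. y < \<sigma> n \<omega>} = prob (active n) * tail H y"
  using active_jump_indep[of n "{y<..}"] tail_eq[of n y]
  by (simp add: Int_def active_def conj_ac)

lemma jump_info: "{\<omega> \<in> space M. y < \<sigma> n \<omega>} \<in> sets (info {n} {})"
proof -
  have "\<sigma> n \<in> borel_measurable (info {n} {})" by (rule info_\<sigma>) auto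
  then have "{\<omega> \<in> space (info {n} {}). y < \<sigma> n \<omega>} \<in> sets (info {n} {})" by measurable
  then show ?thesis by simp
qed

text \<open>Replace the inter-arrival times by smaller ones that are at most \<open>K\<close> and stop the walk at the end
of the busy period. Before the end it dominates the positive original walk, and the last step loses
at most \<open>K\<close>. The statement carries both facts along the induction.\<close>

lemma truncated_walk_bounded_below:
  assumes reg: "regular \<omega>" and s: "\<And>k. k \<ge> 1 \<Longrightarrow> s k \<le> t k \<omega>" "\<And>k. k \<ge> 1 \<Longrightarrow> s k \<le> K" and K: "0 \<le> K"
    and sp: "\<omega> \<in> space M"
  shows "(\<omega> \<in> active (Suc n) \<longrightarrow> walk t \<sigma> n \<omega> \<le> (\<Sum>k=1..n. indicator (active k) \<omega> * (\<sigma> k \<omega> - s k)))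
    \<and> - K \<le> (\<Sum>k=1..n. indicator (active k) \<omega> * (\<sigma> k \<omega> - s k))"
proof (induction n)
  case 0
  then show ?case using K by (simp add: walk_def)
next
  case (Suc n)
  let ?V = "\<lambda>n. \<Sum>k=1..n. indicator (active k) \<omega> * (\<sigma> k \<omega> - s k)"
  show ?case
  proof (cases "\<omega> \<in> active (Suc n)")
    case True
    have w: "0 \<le> walk t \<sigma> n \<omega>"
      using True by (cases "n = 0") (auto simp: walk_def active_def num_served_ge_iff less_imp_le)
    have V: "?V (Suc n) = ?V n + (\<sigma> (Suc n) \<omega> - s (Suc n))" using True by simp
    have "0 \<le> \<sigma> (Suc n) \<omega>" using reg by (simp add: regular_def)
    moreover have "walk t \<sigma> (Suc n) \<omega> = walk t \<sigma> n \<omega> + (\<sigma> (Suc n) \<omega> - t (Suc n) \<omega>)" by (simp add: walk_def)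
    ultimately show ?thesis unfolding V using Suc.IH True w s[of "Suc n"] by auto
  next
    case False
    then have "\<omega> \<notin> active (Suc (Suc n))" using active_antimono[of "Suc n" "Suc (Suc n)"] by auto
    then show ?thesis using False Suc.IH by simp
  qed
qed

end

section \<open>Finite mean number of customers in the busy period\<close>

locale stable_irv_queue = gi_gi_1_queue +
  assumes stable: "b < a" and irv: "intermediate_regularly_varying H"

begin

lemma rho_bounds: "0 < b / a" "b / a < 1"
  using stable a_pos b_pos by auto

text \<open>Wald's identity for the stopped walk. Truncating the inter-arrival times at a high level keeps the
drift \<open>b - c\<close> negative. The expectation of the stopped truncated walk is the drift times
the expected number of steps, while the walk itself never falls below \<open>- K\<close>.\<close>

lemma sum_active_bounded: "\<exists>C. \<forall>n. (\<Sum>k=1..n. prob (active k)) \<le> C"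
proof -
  let ?T = "distr M borel (t 1)"
  have t_D: "integrable ?T (\<lambda>x. x)" "(\<integral>x. x \<partial>?T) = a"
    using integrable_t mean_t by (simp_all add: integrable_distr_eq integral_distr)
  obtain K where K: "K > 0" "(\<integral>x. \<bar>x - (if \<bar>x\<bar> \<le> K then x else 0)\<bar> \<partial>?T) \<le> (a-b)/2"
    using truncation_approx[OF _ t_D(1), of "(a-b)/2"] stable by auto
  define f where "f x = (if \<bar>x\<bar> \<le> K then x else 0)" for x :: real
  have [measurable]: "f \<in> borel_measurable borel" unfolding f_def by measurable
  have "integrable ?T f"
    by (rule Bochner_Integration.integrable_bound[OF t_D(1)]) (auto simp: f_def)
  have f_int: "integrable M (\<lambda>\<omega>. f (t k \<omega>))" "expectation (\<lambda>\<omega>. f (t k \<omega>)) = (\<integral>x. f x \<partial>?T)" if k: "k \<ge> 1" for k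
  proof -
    note [measurable] = rv_t[OF k]
    have "integrable (distr M borel (t k)) f" unfolding ident_t[OF k] by fact
    then show "integrable M (\<lambda>\<omega>. f (t k \<omega>))" by (subst (asm) integrable_distr_eq) auto
    show "expectation (\<lambda>\<omega>. f (t k \<omega>)) = (\<integral>x. f x \<partial>?T)"
      unfolding ident_t[OF k, symmetric] by (subst integral_distr) auto
  qed
  define c where "c = (\<integral>x. f x \<partial>?T)"
  have "a - c = (\<integral>x. x - f x \<partial>?T)" using t_D \<open>integrable ?T f\<close> by (simp add: c_def)
  also have "\<dots> \<le> (\<integral>x. \<bar>x - f x\<bar> \<partial>?T)"
    using t_D \<open>integrable ?T f\<close> by (intro integral_mono) auto
  also have "\<dots> \<le> (a - b)/2" using K(2) by (simp add: f_def)
  finally have c: "b < c" using stable by (simp add: field_simps)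
  have E: "integrable M (\<lambda>\<omega>. indicator (active k) \<omega> * (\<sigma> k \<omega> - f (t k \<omega>)))"
    "expectation (\<lambda>\<omega>. indicator (active k) \<omega> * (\<sigma> k \<omega> - f (t k \<omega>))) = prob (active k) * (b - c)"
    if k: "k \<ge> 1" for k
  proof -
    \<comment> \<open>Activity of customer \<open>k\<close> is decided before \<open>k\<close>.\<close>
    have ind: "indep_var borel (indicator (active k) :: 'a \<Rightarrow> real) borel (\<lambda>\<omega>. \<sigma> k \<omega> - f (t k \<omega>))"
    proof (rule indep_var_info)
      show "(indicator (active k) :: 'a \<Rightarrow> real) \<in> borel_measurable (info {1..<k} {1..<k})"
        by (intro borel_measurable_indicator active_info) auto
      have "(\<lambda>\<omega>. f (t k \<omega>)) \<in> borel_measurable (info {k} {k})"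
        by (rule measurable_compose[OF info_t]) auto
      then show "(\<lambda>\<omega>. \<sigma> k \<omega> - f (t k \<omega>)) \<in> borel_measurable (info {k} {k})"
        by (intro borel_measurable_diff info_\<sigma>) auto
    qed (use k in auto)
    have int: "integrable M (indicator (active k) :: 'a \<Rightarrow> real)" "integrable M (\<lambda>\<omega>. \<sigma> k \<omega> - f (t k \<omega>))"
      using integrable_\<sigma>[OF k] f_int[OF k] by (auto simp: integrable_indicator_iff less_top[symmetric])
    show "integrable M (\<lambda>\<omega>. indicator (active k) \<omega> * (\<sigma> k \<omega> - f (t k \<omega>)))"
      by (rule indep_var_integrable[OF ind int])
    show "expectation (\<lambda>\<omega>. indicator (active k) \<omega> * (\<sigma> k \<omega> - f (t k \<omega>))) = prob (active k) * (b - c)"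
      unfolding indep_var_lebesgue_integral[OF ind int]
      using integrable_\<sigma>[OF k] f_int[OF k] mean_\<sigma>[OF k] by (simp add: c_def)
  qed
  have "(\<Sum>k=1..n. prob (active k)) \<le> K / (c - b)" for n
  proof -
    have "- K = expectation (\<lambda>_. - K)" by (simp add: prob_space)
    also have "\<dots> \<le> expectation (\<lambda>\<omega>. \<Sum>k=1..n. indicator (active k) \<omega> * (\<sigma> k \<omega> - f (t k \<omega>)))"
    proof (rule integral_mono_AE)
      show "AE \<omega> in M. - K \<le> (\<Sum>k=1..n. indicator (active k) \<omega> * (\<sigma> k \<omega> - f (t k \<omega>)))"
        using AE_regular AE_space
      proof eventually_elim
        case (elim \<omega>)
        then show ?case
          using truncated_walk_bounded_below[of \<omega> "\<lambda>k. f (t k \<omega>)" K n] K(1)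
          by (auto simp: f_def regular_def)
      qed
    qed (simp, intro Bochner_Integration.integrable_sum E(1), simp)
    also have "\<dots> = (\<Sum>k=1..n. prob (active k)) * (b - c)"
      using E by (subst Bochner_Integration.integral_sum) (auto simp: sum_distrib_right)
    finally show ?thesis using c by (simp add: field_simps)
  qed
  then show ?thesis by blast
qed

text \<open>The tail-sum formula for \<open>E \<tau>\<close>.\<close>

definition mean_served :: real where
  "mean_served = (\<Sum>n. prob (active (Suc n)))"

lemma summable_active: "summable (\<lambda>n. prob (active (Suc n)))"
proof -
  obtain C where C: "\<And>n. (\<Sum>k=1..n. prob (active k)) \<le> C" using sum_active_bounded by blast
  have "(\<Sum>k<n. prob (active (Suc k))) \<le> C" for n
    using C[of n] by (simp add: sum.atLeast1_atMost_eq)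
  then have "(\<Sum>k\<le>n. prob (active (Suc k))) \<le> C" for n
    by (metis lessThan_Suc_atMost)
  then show ?thesis by (intro bounded_imp_summable) auto
qed

lemma mean_served_partial: "(\<Sum>k=1..n. prob (active k)) \<le> mean_served"
proof -
  have "(\<Sum>k=1..n. prob (active k)) = (\<Sum>k<n. prob (active (Suc k)))"
    by (simp add: sum.atLeast1_atMost_eq)
  also have "\<dots> \<le> mean_served"
    unfolding mean_served_def by (intro sum_le_suminf summable_active) auto
  finally show ?thesis .
qed

lemma mean_served_ge_1: "1 \<le> mean_served"
  using mean_served_partial[of 1] by (simp add: active_1 prob_space)

lemma mean_served_approx: "\<delta> > 0 \<Longrightarrow> \<exists>N\<ge>1. \<forall>n\<ge>N. mean_served - \<delta> < (\<Sum>k=1..n. prob (active k))"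
proof -
  assume \<delta>: "\<delta> > 0"
  have "(\<lambda>n. \<Sum>k<n. prob (active (Suc k))) \<longlonglongrightarrow> mean_served"
    unfolding mean_served_def by (rule summable_LIMSEQ[OF summable_active])
  from order_tendstoD(1)[OF this, of "mean_served - \<delta>"] \<delta>
  obtain N where "\<And>n. n \<ge> N \<Longrightarrow> mean_served - \<delta> < (\<Sum>k<n. prob (active (Suc k)))"
    by (auto simp: eventually_sequentially)
  then show ?thesis by (intro exI[of _ "Suc N"]) (auto simp: sum.atLeast1_atMost_eq)
qed

definition jump :: "real \<Rightarrow> 'a set" where
  "jump y = (\<Union>n\<in>{1..}. {\<omega> \<in> active n. y < \<sigma> n \<omega>})"

lemma single_jump_events[measurable]: "n \<ge> 1 \<Longrightarrow> {\<omega> \<in> active n. y < \<sigma> n \<omega>} \<in> events"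
proof -
  assume n: "n \<ge> 1"
  have "{\<omega> \<in> active n. y < \<sigma> n \<omega>} = active n \<inter> {\<omega> \<in> space M. y < \<sigma> n \<omega>}" by (auto simp: active_def)
  then show ?thesis using n by simp
qed

lemma jump_events[measurable]: "jump y \<in> events"
  unfolding jump_def by (intro sets.countable_UN') auto

text \<open>Union bound. Since being served in the busy period is independent of one's own service time, the
\<open>n\<close>-th event has probability \<open>P (\<tau> \<ge> n)\<close> times the tail; what is left
is a remainder of the convergent series for \<open>E \<tau>\<close>, small with respect to the tail uniformly in \<open>y\<close>.\<close>

lemma prob_late_jump_le:
  "prob (\<Union>n\<in>{N<..}. {\<omega> \<in> active n. y < \<sigma> n \<omega>}) \<le> (mean_served - (\<Sum>n=1..N. prob (active n))) * tail H y"
proof -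
  have eq: "(\<Union>n\<in>{N<..}. {\<omega> \<in> active n. y < \<sigma> n \<omega>}) = (\<Union>k. {\<omega> \<in> active (Suc (k + N)). y < \<sigma> (Suc (k + N)) \<omega>})"
  proof -
    have "{N<..} = range (\<lambda>k. Suc (k + N))"
      by (auto simp: image_iff) (metis add.commute less_imp_Suc_add)
    then show ?thesis by simp
  qed
  have p: "prob {\<omega> \<in> active (Suc n). y < \<sigma> (Suc n) \<omega>} = prob (active (Suc n)) * tail H y" for n
    by (rule active_jump) simp
  have s: "summable (\<lambda>k. prob (active (Suc (k + N))))"
    using summable_active by (subst summable_iff_shift[of "\<lambda>k. prob (active (Suc k))" N])
  have "prob (\<Union>k. {\<omega> \<in> active (Suc (k + N)). y < \<sigma> (Suc (k + N)) \<omega>})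
      \<le> (\<Sum>k. prob {\<omega> \<in> active (Suc (k + N)). y < \<sigma> (Suc (k + N)) \<omega>})"
    by (rule finite_measure_subadditive_countably) (auto simp: p intro!: summable_mult2 s)
  also have "\<dots> = (\<Sum>k. prob (active (Suc (k + N)))) * tail H y"
    unfolding p by (rule suminf_mult2[symmetric, OF s])
  also have "(\<Sum>k. prob (active (Suc (k + N)))) = mean_served - (\<Sum>k<N. prob (active (Suc k)))"
    unfolding mean_served_def by (rule suminf_minus_initial_segment[OF summable_active])
  also have "(\<Sum>k<N. prob (active (Suc k))) = (\<Sum>n=1..N. prob (active n))"
    by (simp add: sum.atLeast1_atMost_eq)
  finally show ?thesis unfolding eq .
qed

lemma prob_jump_le: "prob (jump y) \<le> mean_served * tail H y"
proof -
  have eq: "{1..} = {0::nat<..}" by auto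
  show ?thesis unfolding jump_def eq by (rule order_trans[OF prob_late_jump_le]) simp
qed

section \<open>The upper bound\<close>

lemma tail_pos: "0 < tail H x"
  using irv by (simp add: intermediate_regularly_varying_def)

text \<open>Iterating the comparison for one factor \<open>\<alpha> > 1\<close> reaches every factor at a bounded price.\<close>

lemma tail_dominated:
  assumes "0 < \<epsilon>"
  shows "\<exists>D>0. \<forall>\<^sub>F x in at_top. tail H (\<epsilon> * x) \<le> D * tail H x"
proof -
  obtain \<alpha> where \<alpha>: "\<alpha> > 1" "\<forall>\<^sub>F x in at_top. 1/2 * tail H x \<le> tail H (\<alpha> * x)"
    using irv_ratio[OF irv, of "1/2"] by auto
  have it: "\<forall>\<^sub>F x in at_top. (1/2)^k * tail H x \<le> tail H (\<alpha>^k * x)" for k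
  proof (induction k)
    case (Suc k)
    have "\<forall>\<^sub>F x in at_top. 1/2 * tail H (\<alpha>^k * x) \<le> tail H (\<alpha> * (\<alpha>^k * x))"
      by (rule eventually_scale[OF \<alpha>(2)]) (use \<alpha> in simp)
    with Suc show ?case by eventually_elim (simp add: mult_ac)
  qed simp
  obtain k where k: "1/\<epsilon> < \<alpha>^k" using real_arch_pow[OF \<alpha>(1)] by blast
  have "\<forall>\<^sub>F x in at_top. tail H (\<epsilon> * x) \<le> 2^k * tail H x"
    using eventually_scale[OF it[of k] assms] eventually_ge_at_top[of 0]
  proof eventually_elim
    case (elim x)
    have "1 * x \<le> (\<alpha>^k * \<epsilon>) * x" using k assms elim(2) by (intro mult_right_mono) (auto simp: field_simps)
    then have "tail H (\<alpha>^k * (\<epsilon> * x)) \<le> tail H x" by (intro tail_antimono) (simp add: mult.assoc)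
    moreover have "tail H (\<epsilon> * x) \<le> 2^k * tail H (\<alpha>^k * (\<epsilon> * x))"
      using elim(1) by (simp add: power_one_over field_simps)
    ultimately show ?case by (meson mult_left_mono order_trans zero_le_numeral zero_le_power)
  qed
  then show ?thesis by (intro exI[of _ "2^k"]) auto
qed

text \<open>If the accumulated service after customer \<open>n\<close> is at most \<open>u x\<close>, then so is the walk. On a typical
block of \<open>m\<close> further customers it loses at least \<open>m (a - b - 2 \<eta>)\<close>, so it reaches zero within the block,
and meanwhile at most \<open>m (b + \<eta>)\<close> units of service are added.\<close>

lemma drain_pathwise:
  assumes \<omega>: "\<omega> \<in> space M" "regular \<omega>" and n: "n \<ge> 1" and act: "work \<sigma> n \<omega> \<le> u * x"
    and dev: "\<omega> \<notin> deviates \<eta> n m" and x: "0 \<le> x"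
    and up: "u * x + m * (b + \<eta>) \<le> x" and down: "u * x \<le> m * (a - b - 2 * \<eta>)"
  shows "\<omega> \<notin> busy x"
proof
  assume "\<omega> \<in> busy x"
  then obtain k where k: "k \<ge> 1" "\<omega> \<in> active k" "x < work \<sigma> k \<omega>"
    using busy_iff[OF \<omega>(2,1) x] by blast
  have nn: "\<forall>i\<ge>1. 0 \<le> \<sigma> i \<omega>" "\<forall>i\<ge>1. 0 \<le> t i \<omega>" using \<omega>(2) by (auto simp: regular_def)
  have s: "\<bar>(\<Sum>i\<in>{n<..n+m}. \<sigma> i \<omega>) - m * b\<bar> \<le> \<eta> * m" "\<bar>(\<Sum>i\<in>{n<..n+m}. t i \<omega>) - m * a\<bar> \<le> \<eta> * m"
    using dev \<omega>(1) by (auto simp: deviates_def not_less)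
  have W: "work \<sigma> (n + m) \<omega> \<le> u * x + m * (b + \<eta>)"
    unfolding work_add using act s(1) by (simp add: algebra_simps)
  show False
  proof (cases "k \<le> n + m")
    case True
    have "work \<sigma> k \<omega> \<le> work \<sigma> (n + m) \<omega>" by (rule work_mono) (use nn True in auto)
    then show False using W up k(3) by linarith
  next
    case False
    then have "0 < walk t \<sigma> (n + m) \<omega>"
      using k(2) n by (auto simp: active_def num_served_ge_iff)
    moreover have "0 \<le> work t n \<omega>" unfolding work_def using nn(2) by (intro sum_nonneg) auto
    then have "m * (a - \<eta>) \<le> work t (n + m) \<omega>"
      unfolding work_add using s(2) by (simp add: algebra_simps)
    ultimately show False
      using W down unfolding walk_eq_work by (simp add: algebra_simps)
  qed
qed

text \<open>A walk at height \<open>u x\<close> needs about \<open>u x / (a - b)\<close> customers to come down, who bring about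
\<open>u x b / (a - b)\<close> units of service. Together with the \<open>u x\<close> already accumulated this stays below \<open>x\<close>
exactly when \<open>u < 1 - b / a\<close>. So a busy period that becomes long from such a position
has to violate the law of large numbers in the future of \<open>n\<close>.\<close>

lemma drain:
  assumes u: "0 \<le> u" "u < 1 - b / a" and \<delta>: "\<delta> > 0"
  shows "\<forall>\<^sub>F x in at_top. \<exists>m \<eta>. (\<forall>n. prob (deviates \<eta> n m) \<le> \<delta>) \<and>
    (\<forall>n\<ge>1. \<forall>\<omega>. regular \<omega> \<longrightarrow> \<omega> \<in> busy x \<longrightarrow> work \<sigma> n \<omega> \<le> u * x \<longrightarrow> \<omega> \<in> deviates \<eta> n m)"
proof -
  define A where "A = a - b"
  have A: "A > 0" using stable by (simp add: A_def)
  \<comment> \<open>The number of further customers per unit of \<open>x\<close>: the midpoint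
      between the rate at which the walk is down and the rate at which the service exceeds
      \<open>x\<close>.\<close>
  define r where "r = (u / A + (1 - u) / b) / 2"
  have u1: "u < 1" using u(2) a_pos b_pos by (smt (verit) divide_pos_pos)
  have key: "u * b < (1 - u) * A" using u(2) a_pos by (simp add: A_def field_simps)
  have r: "r > 0" using u(1) u1 A b_pos by (auto simp: r_def intro!: add_nonneg_pos)
  have "u / A < (1 - u) / b" using key A b_pos by (simp add: field_simps)
  then have "u / A < r" "r < (1 - u) / b"
    unfolding r_def using less_half_sum gt_half_sum by (metis mult_2 one_add_one)+
  then have r2: "u < r * A" "r * b < 1 - u" using A b_pos by (simp_all add: field_simps)
  \<comment> \<open>The tolerance uses up at most the first gap and half of the second one; the
      other half of the second absorbs the rounding of \<open>r x\<close> to an integer.\<close>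
  define \<eta> where "\<eta> = min ((r * A - u) / (2 * r)) ((1 - u - r * b) / (2 * r))"
  have \<eta>: "\<eta> > 0" using r r2 by (simp add: \<eta>_def)
  have "\<eta> \<le> (r * A - u) / (2 * r)" "\<eta> \<le> (1 - u - r * b) / (2 * r)" by (simp_all add: \<eta>_def)
  then have \<eta>2: "u \<le> r * (A - 2 * \<eta>)" "2 * r * \<eta> \<le> 1 - u - r * b"
    using r by (simp_all add: field_simps)
  have \<eta>3: "0 < 1 - u - r * (b + \<eta>)" using \<eta>2(2) r2(2) r \<eta> by (simp add: algebra_simps)
  obtain N where N: "\<And>m n. m \<ge> N \<Longrightarrow> prob (deviates \<eta> n m) \<le> \<delta>"
    using deviates_small[OF \<eta> \<delta>] by blast
  show ?thesis
    using eventually_ge_at_top[of 0] eventually_ge_at_top[of "N / r"]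
      eventually_ge_at_top[of "(b + \<eta>) / (1 - u - r * (b + \<eta>))"]
  proof eventually_elim
    case (elim x)
    define m where "m = nat \<lceil>r * x\<rceil>"
    have m: "r * x \<le> m" "m \<le> r * x + 1" using elim(1) r by (auto simp: m_def)
    have "N \<le> m" using elim(2) m(1) r by (simp add: field_simps)
    moreover have "u * x + m * (b + \<eta>) \<le> x"
    proof -
      have "m * (b + \<eta>) \<le> (r * x + 1) * (b + \<eta>)" using m(2) b_pos \<eta> by (intro mult_right_mono) auto
      moreover have "b + \<eta> \<le> x * (1 - u - r * (b + \<eta>))" using elim(3) \<eta>3 by (simp add: field_simps)
      ultimately show ?thesis by (simp add: algebra_simps)
    qed
    moreover have "u * x \<le> m * (a - b - 2 * \<eta>)"
    proof -
      have "0 \<le> r * (A - 2 * \<eta>)" using \<eta>2(1) u(1) by linarith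
      then have "0 \<le> A - 2 * \<eta>" using r by (simp add: zero_le_mult_iff)
      then have "(r * x) * (A - 2 * \<eta>) \<le> m * (A - 2 * \<eta>)" using m(1) by (intro mult_right_mono)
      moreover have "u * x \<le> (r * (A - 2 * \<eta>)) * x" using \<eta>2(1) elim(1) by (intro mult_right_mono)
      ultimately show ?thesis by (simp add: A_def mult_ac)
    qed
    ultimately show ?case
      using N drain_pathwise[where x=x and u=u and m=m and \<eta>=\<eta>] elim(1)
      by (intro exI[of _ m] exI[of _ \<eta>]) auto
  qed
qed

text \<open>Without a jump above \<open>\<epsilon> x\<close>, the accumulated service is at most \<open>2 \<epsilon> x\<close> when it first exceeds
\<open>\<epsilon> x\<close>. From there the busy period must violate the law of large numbers to become longer
than \<open>x\<close>, which has a small probability and is independent of the passage. The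
passage itself already forces a busy period longer than \<open>\<epsilon> x\<close>, and this is what makes the estimate
recursive.\<close>

lemma busy_no_jump:
  assumes \<epsilon>: "0 < \<epsilon>" "2 * \<epsilon> < 1 - b / a" and \<delta>: "\<delta> > 0"
  shows "\<forall>\<^sub>F x in at_top. prob (busy x - jump (\<epsilon> * x)) \<le> \<delta> * prob (busy (\<epsilon> * x))"
proof -
  have "0 \<le> 2 * \<epsilon>" using \<epsilon>(1) by simp
  from drain[OF this \<epsilon>(2) \<delta>] eventually_gt_at_top[of 0] show ?thesis
  proof eventually_elim
    case (elim x)
    have x: "x > 0" by fact
    from elim(1) obtain m \<eta> where dev: "\<And>n. prob (deviates \<eta> n m) \<le> \<delta>"
      "\<And>n \<omega>. n \<ge> 1 \<Longrightarrow> regular \<omega> \<Longrightarrow> \<omega> \<in> busy x \<Longrightarrow> work \<sigma> n \<omega> \<le> 2 * \<epsilon> * x \<Longrightarrow> \<omega> \<in> deviates \<eta> n m"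
      by blast
    \<comment> \<open>\<open>Suc n\<close> is the first customer at which the accumulated service
        exceeds \<open>\<epsilon> x\<close>.\<close>
    define D where "D n = {\<omega> \<in> active (Suc n). \<epsilon> * x < work \<sigma> (Suc n) \<omega> \<and> (\<forall>k\<in>{..n}. work \<sigma> k \<omega> \<le> \<epsilon> * x)}" for n
    have D_info: "D n \<in> sets (info {1..Suc n} {1..Suc n})" for n
    proof -
      have wk: "work \<sigma> k \<in> borel_measurable (info {1..Suc n} {1..Suc n})" if "k \<le> Suc n" for k
        using that by (intro work_info) auto
      have "{\<omega> \<in> space (info {1..Suc n} {1..Suc n}). \<forall>k\<in>{..n}. work \<sigma> k \<omega> \<le> \<epsilon> * x} \<in> sets (info {1..Suc n} {1..Suc n})"
        by (intro sets.sets_Collect_finite_All borel_measurable_le wk) auto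
      moreover have "{\<omega> \<in> space (info {1..Suc n} {1..Suc n}). \<epsilon> * x < work \<sigma> (Suc n) \<omega>} \<in> sets (info {1..Suc n} {1..Suc n})"
        by (intro borel_measurable_less wk) auto
      moreover have "active (Suc n) \<in> sets (info {1..Suc n} {1..Suc n})" by (rule active_info) auto
      moreover have "D n = active (Suc n) \<inter> {\<omega> \<in> space (info {1..Suc n} {1..Suc n}). \<epsilon> * x < work \<sigma> (Suc n) \<omega>}
        \<inter> {\<omega> \<in> space (info {1..Suc n} {1..Suc n}). \<forall>k\<in>{..n}. work \<sigma> k \<omega> \<le> \<epsilon> * x}"
        by (auto simp: D_def active_def)
      ultimately show ?thesis by (auto intro!: sets.Int)
    qed
    have D_ev: "D n \<in> events" for n
      using D_info[of n] sets_info_subset[of "{1..Suc n}" "{1..Suc n}"] by auto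
    have disj: "disjoint_family D"
      unfolding disjoint_family_on_def
    proof (intro ballI impI)
      fix i j :: nat assume "i \<noteq> j"
      moreover have "D i \<inter> D j = {}" if "i < j" for i j
      proof -
        have "\<epsilon> * x < work \<sigma> (Suc i) \<omega>" "work \<sigma> (Suc i) \<omega> \<le> \<epsilon> * x" if "\<omega> \<in> D i" "\<omega> \<in> D j" for \<omega>
          using that \<open>i < j\<close> by (auto simp: D_def)
        then show ?thesis by fastforce
      qed
      ultimately show "D i \<inter> D j = {}" by (metis Int_commute linorder_neqE_nat)
    qed
    have P: "prob (D n \<inter> deviates \<eta> (Suc n) m) \<le> \<delta> * prob (D n)" for n
      using past_future_indep[OF D_info deviates_info, of n \<eta> m] dev(1)[of "Suc n"]
      mult_left_mono[OF dev(1)[of "Suc n"], of "prob (D n)"] by (simp add: mult.commute)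
    have sD: "(\<lambda>n. prob (D n)) sums prob (\<Union>n. D n)"
      using D_ev disj by (intro finite_measure_UNION) auto
    have "prob (busy x - jump (\<epsilon> * x)) \<le> prob (\<Union>n. D n \<inter> deviates \<eta> (Suc n) m)"
    proof (rule prob_mono_regular)
      fix \<omega> assume \<omega>: "\<omega> \<in> space M" "regular \<omega>" "\<omega> \<in> busy x - jump (\<epsilon> * x)"
      then obtain k where k: "k \<ge> 1" "\<omega> \<in> active k" "x < work \<sigma> k \<omega>"
        using busy_iff[of \<omega> x] x by auto
      have "2 * \<epsilon> < 1" using \<epsilon>(2) a_pos b_pos by (smt (verit) divide_pos_pos)
      then have "\<epsilon> * x \<le> x" using x by simp
      then have kx: "\<epsilon> * x < work \<sigma> k \<omega>" using k by linarith
      define n where "n = (LEAST n. \<epsilon> * x < work \<sigma> n \<omega>)"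
      have n: "\<epsilon> * x < work \<sigma> n \<omega>" "n \<le> k" unfolding n_def using kx by (auto intro: LeastI Least_le)
      have n2: "work \<sigma> j \<omega> \<le> \<epsilon> * x" if "j < n" for j
        using not_less_Least[of j] that unfolding n_def by force
      have "n \<noteq> 0"
      proof
        assume "n = 0"
        then have "\<epsilon> * x < 0" using n(1) by (simp add: work_def)
        then show False using \<epsilon>(1) x by (simp add: mult_less_0_iff)
      qed
      then obtain n' where n': "n = Suc n'" using not0_implies_Suc by blast
      have act: "\<omega> \<in> active n" using active_antimono[OF n(2)] k(2) by auto
      then have "\<omega> \<in> D n'" using n n2 n' by (auto simp: D_def)
      moreover have "\<sigma> n \<omega> \<le> \<epsilon> * x" using \<omega>(3) act n' by (force simp: jump_def)
      then have "work \<sigma> n \<omega> \<le> 2 * \<epsilon> * x" using n2[of n'] by (simp add: n' work_Suc)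
      then have "\<omega> \<in> deviates \<eta> (Suc n') m" using dev(2)[of n \<omega>] \<omega> n' by auto
      ultimately show "\<omega> \<in> (\<Union>n. D n \<inter> deviates \<eta> (Suc n) m)" by blast
    qed (use D_ev in auto)
    also have "\<dots> \<le> (\<Sum>n. prob (D n \<inter> deviates \<eta> (Suc n) m))"
      by (rule finite_measure_subadditive_countably)
         (use D_ev P in \<open>auto intro!: summable_comparison_test[OF _ summable_mult[OF sums_summable[OF sD], of \<delta>]]\<close>)
    also have "\<dots> \<le> (\<Sum>n. \<delta> * prob (D n))"
      by (intro suminf_le P summable_mult sums_summable[OF sD] summable_comparison_test[OF _ summable_mult[OF sums_summable[OF sD], of \<delta>]])
         (use P in auto)
    also have "\<dots> = \<delta> * prob (\<Union>n. D n)"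
      using sD by (simp add: suminf_mult sums_iff)
    also have "prob (\<Union>n. D n) \<le> prob (busy (\<epsilon> * x))"
    proof (rule prob_mono_regular)
      fix \<omega> assume "\<omega> \<in> space M" "regular \<omega>" "\<omega> \<in> (\<Union>n. D n)"
      then show "\<omega> \<in> busy (\<epsilon> * x)" using busy_iff[of \<omega> "\<epsilon> * x"] \<epsilon> x by (auto simp: D_def)
    qed auto
    finally show "prob (busy x - jump (\<epsilon> * x)) \<le> \<delta> * prob (busy (\<epsilon> * x))"
      using \<delta> by (simp add: mult_left_mono)
  qed
qed

text \<open>For the ratio \<open>q x\<close> of the two probabilities, the jumps above \<open>\<epsilon> x\<close> and the recursive
estimate without such jumps give \<open>q x \<le> C / 2 + q (\<epsilon> x) / 2\<close> beyond some point \<open>x1\<close>. The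
factor in front of \<open>q (\<epsilon> x)\<close> is below one, so a bound below \<open>x1\<close> propagates to all \<open>x\<close>. This
replaces large deviation estimates for sums of truncated service times, which are too weak when only
the mean of the service time is finite.\<close>

lemma busy_order_bound: "\<exists>C>0. \<forall>x>0. prob (busy x) \<le> C * tail H x"
proof -
  \<comment> \<open>Any \<open>\<epsilon> > 0\<close> with \<open>2 \<epsilon> < 1 - b / a\<close>
      would do.\<close>
  define \<epsilon> where "\<epsilon> = (1 - b / a) / 3"
  have ba: "0 < b / a" "b / a < 1" using stable a_pos b_pos by auto
  have \<epsilon>: "0 < \<epsilon>" "\<epsilon> < 1" "2 * \<epsilon> < 1 - b / a" using ba by (auto simp: \<epsilon>_def)
  obtain D where D: "D > 0" "\<forall>\<^sub>F x in at_top. tail H (\<epsilon> * x) \<le> D * tail H x"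
    using tail_dominated[OF \<epsilon>(1)] by blast
  have "\<forall>\<^sub>F x in at_top. prob (busy x - jump (\<epsilon> * x)) \<le> 1 / (2 * D) * prob (busy (\<epsilon> * x))"
    using D(1) by (intro busy_no_jump[OF \<epsilon>(1,3)]) auto
  then have "\<forall>\<^sub>F x in at_top. tail H (\<epsilon> * x) \<le> D * tail H x \<and>
      prob (busy x - jump (\<epsilon> * x)) \<le> 1 / (2 * D) * prob (busy (\<epsilon> * x)) \<and> x > 0"
    using D(2) by (intro eventually_conj eventually_gt_at_top) auto
  then obtain x1 where x1: "\<And>x. x \<ge> x1 \<Longrightarrow> tail H (\<epsilon> * x) \<le> D * tail H x"
    "\<And>x. x \<ge> x1 \<Longrightarrow> prob (busy x - jump (\<epsilon> * x)) \<le> 1 / (2 * D) * prob (busy (\<epsilon> * x))"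
    "\<And>x. x \<ge> x1 \<Longrightarrow> x > 0"
    by (auto simp: eventually_at_top_linorder)
  define C where "C = max (2 * mean_served * D) (1 / tail H x1)"
  have C: "2 * mean_served * D \<le> C" "1 / tail H x1 \<le> C" by (auto simp: C_def)
  have C0: "C > 0" using C(2) tail_pos[of x1] by (smt (verit) divide_pos_pos)
  \<comment> \<open>Each step of the induction extends the range of the bound by the factor
      \<open>1 / \<epsilon>\<close>.\<close>
  have main: "\<forall>x>0. x \<le> x1 / \<epsilon>^k \<longrightarrow> prob (busy x) \<le> C * tail H x" for k
  proof (induction k)
    case 0
    show ?case
    proof (intro allI impI)
      fix x assume "0 < x" "x \<le> x1 / \<epsilon>^0"
      then have "tail H x1 \<le> tail H x" by (intro tail_antimono) auto
      then have "1 \<le> 1 / tail H x1 * tail H x" using tail_pos[of x1] by (simp add: field_simps)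
      also have "\<dots> \<le> C * tail H x" using C(2) tail_nonneg by (intro mult_right_mono) auto
      finally show "prob (busy x) \<le> C * tail H x" using prob_le_1[of "busy x"] by linarith
    qed
  next
    case (Suc k)
    show ?case
    proof (intro allI impI)
      fix x assume x: "0 < x" "x \<le> x1 / \<epsilon>^Suc k"
      show "prob (busy x) \<le> C * tail H x"
      proof (cases "x \<le> x1")
        case True
        then have "x \<le> x1 / \<epsilon>^k" using \<epsilon> x(1)
          by (simp add: pos_le_divide_eq) (smt (verit) mult_left_le power_le_one zero_le_power)
        then show ?thesis using Suc.IH x(1) by blast
      next
        case False
        then have xx: "x \<ge> x1" by simp
        have "\<epsilon> * x \<le> x1 / \<epsilon>^k" using x(2) \<epsilon>(1) by (simp add: field_simps)
        then have IH: "prob (busy (\<epsilon> * x)) \<le> C * tail H (\<epsilon> * x)" using Suc.IH x(1) \<epsilon>(1) by simp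
        have "prob (busy x) \<le> prob (jump (\<epsilon> * x) \<union> (busy x - jump (\<epsilon> * x)))"
          by (rule finite_measure_mono) auto
        also have "\<dots> \<le> prob (jump (\<epsilon> * x)) + prob (busy x - jump (\<epsilon> * x))"
          by (rule measure_Un_le) auto
        also have "\<dots> \<le> mean_served * tail H (\<epsilon> * x) + 1 / (2 * D) * (C * tail H (\<epsilon> * x))"
          using x1(2)[OF xx] IH D(1) by (intro add_mono prob_jump_le order_trans[OF x1(2)[OF xx]] mult_left_mono) auto
        also have "\<dots> = (mean_served + C / (2 * D)) * tail H (\<epsilon> * x)" by (simp add: algebra_simps)
        also have "\<dots> \<le> (mean_served + C / (2 * D)) * (D * tail H x)"
          using x1(1)[OF xx] mean_served_ge_1 C0 D(1) by (intro mult_left_mono) auto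
        also have "\<dots> = (mean_served * D + C / 2) * tail H x" using D(1) by (simp add: field_simps)
        also have "\<dots> \<le> C * tail H x" using C(1) tail_nonneg by (intro mult_right_mono) auto
        finally show ?thesis .
      qed
    qed
  qed
  show ?thesis
  proof (intro exI[of _ C] conjI allI impI C0)
    fix x :: real assume x: "x > 0"
    have x10: "x1 > 0" using x1(3)[of x1] by simp
    obtain k where "x / x1 < (1 / \<epsilon>)^k" using real_arch_pow[of "1/\<epsilon>"] \<epsilon> by auto
    then have "x \<le> x1 / \<epsilon>^k" using x10 \<epsilon>(1) by (simp add: field_simps)
    then show "prob (busy x) \<le> C * tail H x" using main x by blast
  qed
qed

text \<open>A jump of size at most \<open>c x\<close> leaves the accumulated service below \<open>u x\<close> with
\<open>u < 1 - b / a\<close>, up to the work before the jump, which is of order one because \<open>n\<close> is fixed.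
Both exceptional events are independent of the jump.\<close>

lemma busy_moderate_jump:
  assumes n: "n \<ge> 1" and c: "0 < c" "c < 1 - b / a" and \<epsilon>: "\<epsilon> > 0" and \<delta>: "\<delta> > 0"
  shows "\<forall>\<^sub>F x in at_top. prob {\<omega> \<in> busy x. \<epsilon> * x < \<sigma> n \<omega> \<and> \<sigma> n \<omega> \<le> c * x} \<le> \<delta> * tail H (\<epsilon> * x)"
proof -
  \<comment> \<open>Half of the gap between \<open>c\<close> and \<open>1 - b / a\<close> is left
      for the work before the jump.\<close>
  define \<eta> where "\<eta> = (1 - b / a - c) / 2"
  have \<eta>: "\<eta> > 0" "c + \<eta> < 1 - b / a" using c by (auto simp: \<eta>_def field_simps)
  have "\<forall>\<^sub>F y in at_top. prob {\<omega> \<in> space M. y < work \<sigma> (n - 1) \<omega>} < \<delta> / 2"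
    using \<delta> by (intro order_tendstoD(2)[OF tail_prob_tendsto_0]) auto
  then have small: "\<forall>\<^sub>F x in at_top. prob {\<omega> \<in> space M. \<eta> * x < work \<sigma> (n - 1) \<omega>} < \<delta> / 2"
    by (rule eventually_scale) (rule \<eta>)
  have u: "0 \<le> c + \<eta>" using c \<eta> by simp
  have \<delta>2: "\<delta> / 2 > 0" using \<delta> by simp
  show ?thesis using small drain[OF u \<eta>(2) \<delta>2]
  proof eventually_elim
    case (elim x)
    from elim(2) obtain m \<kappa> where dev: "\<And>n. prob (deviates \<kappa> n m) \<le> \<delta> / 2"
      "\<And>n \<omega>. n \<ge> 1 \<Longrightarrow> regular \<omega> \<Longrightarrow> \<omega> \<in> busy x \<Longrightarrow> work \<sigma> n \<omega> \<le> (c + \<eta>) * x \<Longrightarrow> \<omega> \<in> deviates \<kappa> n m"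
      by blast
    let ?J = "{\<omega> \<in> space M. \<epsilon> * x < \<sigma> n \<omega>}" and ?W = "{\<omega> \<in> space M. \<eta> * x < work \<sigma> (n - 1) \<omega>}"
    have [measurable]: "?J \<in> events" using rv_\<sigma>[OF n] by measurable
    have "prob {\<omega> \<in> busy x. \<epsilon> * x < \<sigma> n \<omega> \<and> \<sigma> n \<omega> \<le> c * x} \<le> prob ((?J \<inter> ?W) \<union> (?J \<inter> deviates \<kappa> n m))"
    proof (rule prob_mono_regular)
      fix \<omega> assume \<omega>: "\<omega> \<in> space M" "regular \<omega>" "\<omega> \<in> {\<omega> \<in> busy x. \<epsilon> * x < \<sigma> n \<omega> \<and> \<sigma> n \<omega> \<le> c * x}"
      show "\<omega> \<in> (?J \<inter> ?W) \<union> (?J \<inter> deviates \<kappa> n m)"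
      proof (cases "\<omega> \<in> ?W")
        case False
        have "work \<sigma> n \<omega> = work \<sigma> (n - 1) \<omega> + \<sigma> n \<omega>" using n work_Suc[of \<sigma> "n - 1" \<omega>] by simp
        then have "work \<sigma> n \<omega> \<le> (c + \<eta>) * x" using False \<omega> by (simp add: algebra_simps)
        then show ?thesis using dev(2)[OF n \<omega>(2)] \<omega> by blast
      qed (use \<omega> in auto)
    qed auto
    also have "\<dots> \<le> prob (?J \<inter> ?W) + prob (?J \<inter> deviates \<kappa> n m)" by (rule measure_Un_le) auto
    also have "prob (?J \<inter> ?W) = prob ?J * prob ?W"
    proof (rule info_indep)
      have "work \<sigma> (n - 1) \<in> borel_measurable (info {1..<n} {})" by (rule work_info) auto
      then have "{\<omega> \<in> space (info {1..<n} {}). \<eta> * x < work \<sigma> (n - 1) \<omega>} \<in> sets (info {1..<n} {})" by measurable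
      then show "?W \<in> sets (info {1..<n} {})" by simp
    qed (use jump_info n in auto)
    also have "prob (?J \<inter> deviates \<kappa> n m) = prob ?J * prob (deviates \<kappa> n m)"
      by (rule info_indep[OF jump_info deviates_info]) (use n in auto)
    also have "prob ?J * prob ?W + prob ?J * prob (deviates \<kappa> n m) = prob ?J * (prob ?W + prob (deviates \<kappa> n m))"
      by (simp add: algebra_simps)
    also have "\<dots> \<le> prob ?J * \<delta>"
      using elim(1) dev(1)[of n] by (intro mult_left_mono) auto
    finally show ?case using tail_eq[OF n] by (simp add: mult.commute)
  qed
qed

text \<open>A long busy period falls into one of four cases: a jump above \<open>c x\<close>, where \<open>c\<close> is slightly below \<open>1 - b / a\<close>;
a moderate jump of one of the first \<open>N\<close> customers; a jump above \<open>\<epsilon> x\<close> of a later customer;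
no jump above \<open>\<epsilon> x\<close>. The first case gives the main term. The others are small multiples of
the tail at \<open>\<epsilon> x\<close>, hence of the tail at \<open>(1 - b / a) x\<close>; for the last case this uses the a priori bound on
the order of magnitude.\<close>

lemma busy_upper:
  assumes \<delta>: "\<delta> > 0"
  shows "\<forall>\<^sub>F x in at_top. prob (busy x) \<le> (mean_served + \<delta>) * tail H (x * (1 - b / a))"
proof -
  define r where "r = 1 - b / a"
  have r: "0 < r" "r < 1" using rho_bounds by (auto simp: r_def)
  define E where "E = mean_served"
  have E: "E \<ge> 1" using mean_served_ge_1 by (simp add: E_def)
  \<comment> \<open>Chosen so that \<open>E / (1 - \<epsilon>1) = E + \<delta> / 2\<close>.\<close>
  define \<epsilon>1 where "\<epsilon>1 = (\<delta> / 2) / (E + \<delta> / 2)"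
  have \<epsilon>1: "\<epsilon>1 > 0" "1 - \<epsilon>1 = E / (E + \<delta> / 2)" using E \<delta> by (auto simp: \<epsilon>1_def field_simps)
  obtain \<alpha> where \<alpha>: "\<alpha> > 1" "\<forall>\<^sub>F x in at_top. (1 - \<epsilon>1) * tail H x \<le> tail H (\<alpha> * x)"
    using irv_ratio[OF irv \<epsilon>1(1)] by blast
  \<comment> \<open>\<open>\<alpha> c = 1 - b / a\<close>, so the tail at \<open>c x\<close>
      exceeds the one at \<open>(1 - b / a) x\<close> by at most the factor \<open>1 / (1 -
      \<epsilon>1)\<close>.\<close>
  define c where "c = r / \<alpha>"
  have c: "0 < c" "c < r" using r \<alpha> by (auto simp: c_def field_simps)
  define \<epsilon> where "\<epsilon> = c / 2"
  have \<epsilon>: "0 < \<epsilon>" "2 * \<epsilon> < r" using c by (auto simp: \<epsilon>_def)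
  obtain D where D: "D > 0" "\<forall>\<^sub>F x in at_top. tail H (\<epsilon> / r * x) \<le> D * tail H x"
    using tail_dominated[of "\<epsilon> / r"] \<epsilon> r by auto
  obtain C where C: "C > 0" "\<And>x. x > 0 \<Longrightarrow> prob (busy x) \<le> C * tail H x"
    using busy_order_bound by blast
  obtain N where N: "N \<ge> 1" "mean_served - \<delta> / (6 * D) < (\<Sum>k=1..N. prob (active k))"
    using mean_served_approx[of "\<delta> / (6 * D)"] \<delta> D by auto
  have cs: "\<forall>\<^sub>F x in at_top. (1 - \<epsilon>1) * tail H (c * x) \<le> tail H (r * x)"
    using eventually_scale[OF \<alpha>(2) c(1)] by (rule eventually_mono) (use \<alpha> in \<open>simp add: c_def\<close>)
  have Ds: "\<forall>\<^sub>F x in at_top. tail H (\<epsilon> * x) \<le> D * tail H (r * x)"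
    using eventually_scale[OF D(2) r(1)] by (rule eventually_mono) (use r in simp)
  have nojump: "\<forall>\<^sub>F x in at_top. prob (busy x - jump (\<epsilon> * x)) \<le> \<delta> / (6 * D * C) * prob (busy (\<epsilon> * x))"
    using \<epsilon> \<delta> D C by (intro busy_no_jump) (auto simp: r_def)
  have mod: "\<forall>\<^sub>F x in at_top. \<forall>n\<in>{1..N}. prob {\<omega> \<in> busy x. \<epsilon> * x < \<sigma> n \<omega> \<and> \<sigma> n \<omega> \<le> c * x}
      \<le> \<delta> / (6 * D * N) * tail H (\<epsilon> * x)"
    using \<epsilon> \<delta> D N c by (intro eventually_ball_finite ballI busy_moderate_jump) (auto simp: r_def)
  from cs Ds nojump mod eventually_gt_at_top[of 0] show ?thesis
  proof eventually_elim
    case (elim x)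
    let ?h = "tail H (r * x)" and ?e = "tail H (\<epsilon> * x)"
    let ?mod = "\<Union>n\<in>{1..N}. {\<omega> \<in> busy x. \<epsilon> * x < \<sigma> n \<omega> \<and> \<sigma> n \<omega> \<le> c * x}"
    let ?late = "\<Union>n\<in>{N<..}. {\<omega> \<in> active n. \<epsilon> * x < \<sigma> n \<omega>}"
    have modn[measurable]: "{\<omega> \<in> busy x. \<epsilon> * x < \<sigma> n \<omega> \<and> \<sigma> n \<omega> \<le> c * x} \<in> events" if "n \<in> {1..N}" for n
    proof -
      have "n \<ge> 1" using that by simp
      note [measurable] = rv_\<sigma>[OF this]
      have "{\<omega> \<in> busy x. \<epsilon> * x < \<sigma> n \<omega> \<and> \<sigma> n \<omega> \<le> c * x}
        = busy x \<inter> {\<omega> \<in> space M. \<epsilon> * x < \<sigma> n \<omega> \<and> \<sigma> n \<omega> \<le> c * x}" by auto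
      then show ?thesis by simp
    qed
    have ev: "?mod \<in> events" "?late \<in> events"
      using modn by (auto intro!: sets.countable_UN' single_jump_events)
    have "busy x \<subseteq> (jump (c * x) \<union> ?mod) \<union> (?late \<union> (busy x - jump (\<epsilon> * x)))"
    proof
      fix \<omega> assume \<omega>: "\<omega> \<in> busy x"
      show "\<omega> \<in> (jump (c * x) \<union> ?mod) \<union> (?late \<union> (busy x - jump (\<epsilon> * x)))"
      proof (cases "\<omega> \<in> jump (\<epsilon> * x)")
        case True
        then obtain n where n: "n \<ge> 1" "\<omega> \<in> active n" "\<epsilon> * x < \<sigma> n \<omega>" by (auto simp: jump_def)
        then show ?thesis using \<omega> by (cases "n \<le> N"; cases "\<sigma> n \<omega> \<le> c * x") (auto simp: jump_def not_le)
      qed (use \<omega> in auto)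
    qed
    then have "prob (busy x) \<le> prob ((jump (c * x) \<union> ?mod) \<union> (?late \<union> (busy x - jump (\<epsilon> * x))))"
      using ev by (intro finite_measure_mono) auto
    also have "\<dots> \<le> (prob (jump (c * x)) + prob ?mod) + (prob ?late + prob (busy x - jump (\<epsilon> * x)))"
      using ev by (intro order_trans[OF measure_Un_le] add_mono measure_Un_le) auto
    also have "prob (jump (c * x)) \<le> (E + \<delta> / 2) * ?h"
    proof -
      have "E / (E + \<delta> / 2) * tail H (c * x) \<le> ?h" using elim(1) unfolding \<epsilon>1(2) .
      then have "E * tail H (c * x) \<le> (E + \<delta> / 2) * ?h" using E \<delta> by (simp add: field_simps)
      then show ?thesis using prob_jump_le[of "c * x"] by (simp add: E_def)
    qed
    also have "prob ?mod \<le> \<delta> / (6 * D) * ?e"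
    proof -
      have "prob ?mod \<le> (\<Sum>n=1..N. prob {\<omega> \<in> busy x. \<epsilon> * x < \<sigma> n \<omega> \<and> \<sigma> n \<omega> \<le> c * x})"
        using modn by (intro finite_measure_subadditive_finite) auto
      also have "\<dots> \<le> (\<Sum>n=1..N. \<delta> / (6 * D * N) * ?e)" by (intro sum_mono) (use elim(4) in auto)
      also have "\<dots> = \<delta> / (6 * D) * ?e" using N(1) by simp
      finally show ?thesis .
    qed
    also have "prob ?late \<le> \<delta> / (6 * D) * ?e"
      using N(2) tail_nonneg by (intro order_trans[OF prob_late_jump_le] mult_right_mono) auto
    also have "prob (busy x - jump (\<epsilon> * x)) \<le> \<delta> / (6 * D) * ?e"
    proof -
      have "prob (busy (\<epsilon> * x)) \<le> C * ?e" using C(2)[of "\<epsilon> * x"] \<epsilon>(1) elim(5) by simp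
      then have "\<delta> / (6 * D * C) * prob (busy (\<epsilon> * x)) \<le> \<delta> / (6 * D * C) * (C * ?e)"
        using \<delta> D C by (intro mult_left_mono) auto
      then show ?thesis using elim(3) C(1) by simp
    qed
    also have "(E + \<delta> / 2) * ?h + \<delta> / (6 * D) * ?e + (\<delta> / (6 * D) * ?e + \<delta> / (6 * D) * ?e)
        = (E + \<delta> / 2) * ?h + \<delta> / (2 * D) * ?e" using D(1) by (simp add: field_simps)
    also have "\<dots> \<le> (E + \<delta> / 2) * ?h + \<delta> / (2 * D) * (D * ?h)"
      using elim(2) \<delta> D(1) by (intro add_left_mono mult_left_mono) auto
    also have "\<dots> = (E + \<delta>) * ?h" using D(1) by (simp add: field_simps)
    finally show ?case by (simp add: E_def r_def mult.commute)
  qed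
qed

section \<open>The lower bound\<close>

text \<open>After the big service time the walk is above \<open>z - w\<close>. It has to stay positive throughout the
next \<open>J K\<close> customers, so the law of large numbers at the end of that stretch does not suffice. Since
services and arrivals are both increasing sums, it is enough to control them on a grid of mesh \<open>K\<close>
and to pay for one more cell of arrivals.\<close>

lemma takeoff_pathwise:
  fixes n J K :: nat
  assumes \<omega>: "\<omega> \<in> space M" "regular \<omega>" and n: "n \<ge> 1" and act: "\<omega> \<in> active n"
    and big: "z < \<sigma> n \<omega>" and tn: "t n \<omega> \<le> w"
    and dev: "\<And>j. j \<le> J \<Longrightarrow> \<omega> \<notin> deviates \<eta> n (j * K)" and \<eta>: "0 \<le> \<eta>" and x: "0 \<le> x"
    and up: "x \<le> z + J * K * (b - \<eta>)" and down: "w + J * K * (a - b + 2 * \<eta>) + K * (a + \<eta>) \<le> z"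
  shows "\<omega> \<in> busy x"
proof -
  have nn: "\<forall>i\<ge>1. 0 \<le> \<sigma> i \<omega>" "\<forall>i\<ge>1. 0 \<le> t i \<omega>" using \<omega>(2) by (auto simp: regular_def)
  have s: "j * K * (b - \<eta>) \<le> (\<Sum>i\<in>{n<..n+j*K}. \<sigma> i \<omega>)" "(\<Sum>i\<in>{n<..n+j*K}. t i \<omega>) \<le> j * K * (a + \<eta>)"
    if "j \<le> J" for j
    using dev[OF that] \<omega>(1) by (auto simp: deviates_def not_less algebra_simps)
  have pre: "work \<sigma> n \<omega> = work \<sigma> (n - 1) \<omega> + \<sigma> n \<omega>" "work t n \<omega> = work t (n - 1) \<omega> + t n \<omega>"
    using n work_Suc[of \<sigma> "n - 1" \<omega>] work_Suc[of t "n - 1" \<omega>] by auto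
  have w0: "0 \<le> work \<sigma> (n - 1) \<omega> - work t (n - 1) \<omega>"
  proof (cases "n = 1")
    case False
    then have "0 < walk t \<sigma> (n - 1) \<omega>" using act n by (auto simp: active_def num_served_ge_iff)
    then show ?thesis by (simp add: walk_eq_work)
  qed (simp add: work_def)
  have after: "0 < walk t \<sigma> (n + k) \<omega>" if k: "k < J * K" for k
  proof -
    define j where "j = k div K"
    have K: "K > 0" using k by (cases K) auto
    have j: "j < J" using k by (simp add: j_def less_mult_imp_div_less)
    have k2: "j * K \<le> k" "k \<le> Suc j * K"
      using K by (auto simp: j_def dividend_less_div_times intro: less_imp_le)
    have "work \<sigma> (n + j * K) \<omega> \<le> work \<sigma> (n + k) \<omega>" by (rule work_mono) (use nn k2 in auto)
    moreover have "work t (n + k) \<omega> \<le> work t (n + Suc j * K) \<omega>" by (rule work_mono) (use nn k2 in auto)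
    moreover have "work \<sigma> n \<omega> + j * K * (b - \<eta>) \<le> work \<sigma> (n + j * K) \<omega>"
      unfolding work_add using s(1)[of j] j by simp
    moreover have "work t (n + Suc j * K) \<omega> \<le> work t n \<omega> + Suc j * K * (a + \<eta>)"
      unfolding work_add using s(2)[of "Suc j"] j by simp
    moreover have "j * K * (a - b + 2 * \<eta>) \<le> J * K * (a - b + 2 * \<eta>)"
      using j stable \<eta> by (auto intro!: mult_right_mono)
    ultimately show ?thesis
      unfolding walk_eq_work using pre w0 big tn down by (simp add: algebra_simps)
  qed
  have "0 < walk t \<sigma> k \<omega>" if "1 \<le> k" "k < n + J * K" for k
  proof (cases "k < n")
    case True
    then show ?thesis using act that by (auto simp: active_def num_served_ge_iff)
  next
    case False
    then show ?thesis using after[of "k - n"] that by simp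
  qed
  then have "\<omega> \<in> active (n + J * K)" using \<omega>(1) by (auto simp: active_def num_served_ge_iff)
  moreover have "x < work \<sigma> (n + J * K) \<omega>"
  proof -
    have "0 \<le> work \<sigma> (n - 1) \<omega>" unfolding work_def using nn by (intro sum_nonneg) auto
    then show ?thesis unfolding work_add using s(1)[of J] pre(1) big up by simp
  qed
  ultimately show ?thesis unfolding busy_iff[OF \<omega>(2,1) x] using n by (intro exI[of _ "n + J * K"]) auto
qed

text \<open>Converse to draining: a service time slightly above \<open>(1 - b / a) x\<close> keeps the walk positive for about
\<open>x / a\<close> customers, and their services of about \<open>b x / a\<close> raise the total above \<open>x\<close>. The exceptional
event \<open>G\<close> depends on \<open>t n\<close> and the customers after \<open>n\<close> only, so it is independent of the jump.\<close>

lemma takeoff: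
  assumes \<alpha>: "\<alpha> > 1" and \<delta>: "\<delta> > 0"
  shows "\<forall>\<^sub>F x in at_top. \<forall>n\<in>{1..N}. \<exists>G \<in> sets (info ({1..} - {n}) {n..}). prob G \<le> \<delta> \<and>
    (\<forall>\<omega>\<in>space M. regular \<omega> \<longrightarrow> \<omega> \<in> active n \<longrightarrow> \<alpha> * (1 - b / a) * x < \<sigma> n \<omega> \<longrightarrow> \<omega> \<notin> G \<longrightarrow> \<omega> \<in> busy x)"
proof -
  define r where "r = 1 - b / a"
  have r: "0 < r" "r < 1" using rho_bounds by (auto simp: r_def)
  have ra: "r * a = a - b" using a_pos by (simp add: r_def field_simps)
  \<comment> \<open>The slack in the slope of \<open>z = \<alpha> (1 - b / a) x\<close>;
      \<open>w\<close>, the mesh of the grid and the tolerance \<open>\<eta>\<close> each use up a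
      fraction of it, and \<open>\<eta> \<le> b\<close> keeps the lower bound on the services
      monotone in their number.\<close>
  define \<gamma> where "\<gamma> = (\<alpha> - 1) * r"
  have \<gamma>: "\<gamma> > 0" "\<alpha> * r = r + \<gamma>" using \<alpha> r by (auto simp: \<gamma>_def algebra_simps)
  define \<eta> where "\<eta> = min (a * \<gamma> / 16) b"
  have \<eta>: "\<eta> > 0" "\<eta> \<le> a * \<gamma> / 16" "\<eta> \<le> b" using \<gamma> a_pos b_pos by (auto simp: \<eta>_def)
  obtain J where J: "8 / \<gamma> < real J" using reals_Archimedean2 by blast
  have "0 < real J" using J \<gamma>(1) by (smt (verit) divide_pos_pos)
  then have J0: "J \<ge> 1" "1 / J \<le> \<gamma> / 8" using J \<gamma>(1) by (auto simp: field_simps)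
  obtain K0 where K0: "\<And>m n. m \<ge> K0 \<Longrightarrow> prob (deviates \<eta> n m) \<le> \<delta> / (2 * J)"
    using deviates_small[OF \<eta>(1), of "\<delta> / (2 * J)"] \<delta> J0 by auto
  have "\<forall>\<^sub>F y in at_top. prob {\<omega> \<in> space M. y < t n \<omega>} < \<delta> / 2" if "n \<in> {1..N}" for n
    using \<delta> that by (intro order_tendstoD(2)[OF tail_prob_tendsto_0]) auto
  then have "\<forall>\<^sub>F y in at_top. \<forall>n\<in>{1..N}. prob {\<omega> \<in> space M. y < t n \<omega>} < \<delta> / 2"
    by (intro eventually_ball_finite) auto
  from eventually_scale[OF this, of "\<gamma> / 8"] \<gamma>(1)
  have small: "\<forall>\<^sub>F x in at_top. \<forall>n\<in>{1..N}. prob {\<omega> \<in> space M. \<gamma> / 8 * x < t n \<omega>} < \<delta> / 2" by simp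
  show ?thesis
    using small eventually_ge_at_top[of 0] eventually_ge_at_top[of "K0 * (a * J)"]
      eventually_ge_at_top[of "(J * (a - b + 2 * \<eta>) + (a + \<eta>)) / (\<gamma> / 4)"]
  proof eventually_elim
    case (elim x)
    \<comment> \<open>The grid of \<open>J\<close> cells then covers at least \<open>x / a\<close>
        customers and at most \<open>J\<close> more.\<close>
    define K where "K = nat \<lceil>x / (a * J)\<rceil>"
    have K: "x / (a * J) \<le> K" "K \<le> x / (a * J) + 1"
      using elim(2) a_pos by (auto simp: K_def)
    have "K0 \<le> x / (a * J)" using elim(3) a_pos J0 by (simp add: field_simps)
    then have KK: "K0 \<le> K" using K(1) by linarith
    have JK: "x / a \<le> J * K" "J * K \<le> x / a + J"
      using K J0 a_pos by (auto simp: field_simps)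
    show ?case
    proof
      fix n assume n: "n \<in> {1..N}"
      define G where "G = {\<omega> \<in> space M. \<gamma> / 8 * x < t n \<omega>} \<union> (\<Union>j\<in>{1..J}. deviates \<eta> n (j * K))"
      have tG: "{\<omega> \<in> space M. \<gamma> / 8 * x < t n \<omega>} \<in> sets (info ({1..} - {n}) {n..})"
      proof -
        have "t n \<in> borel_measurable (info ({1..} - {n}) {n..})" by (rule info_t) auto
        then have "{\<omega> \<in> space (info ({1..} - {n}) {n..}). \<gamma> / 8 * x < t n \<omega>} \<in> sets (info ({1..} - {n}) {n..})"
          by measurable
        then show ?thesis by simp
      qed
      have dG: "deviates \<eta> n m \<in> sets (info ({1..} - {n}) {n..})" for m
      proof -
        have "{n<..} \<subseteq> {1..} - {n}" "{n<..} \<subseteq> {n..}" by auto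
        then show ?thesis using deviates_info info_mono by blast
      qed
      have G_info: "G \<in> sets (info ({1..} - {n}) {n..})"
        unfolding G_def using tG dG by (intro sets.Un sets.finite_UN) auto
      have sub: "sets (info ({1..} - {n}) {n..}) \<subseteq> events" using n by (intro sets_info_subset) auto
      have "prob G \<le> prob {\<omega> \<in> space M. \<gamma> / 8 * x < t n \<omega>} + prob (\<Union>j\<in>{1..J}. deviates \<eta> n (j * K))"
        unfolding G_def using tG sub by (intro measure_Un_le) auto
      also have "prob (\<Union>j\<in>{1..J}. deviates \<eta> n (j * K)) \<le> (\<Sum>j=1..J. prob (deviates \<eta> n (j * K)))"
        by (intro finite_measure_subadditive_finite) auto
      also have "\<dots> \<le> (\<Sum>j=1..J. \<delta> / (2 * J))"
      proof (intro sum_mono K0)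
        fix j assume "j \<in> {1..J}"
        then have "1 * K \<le> j * K" by (intro mult_right_mono) auto
        then show "K0 \<le> j * K" using KK by linarith
      qed
      also have "\<dots> = \<delta> / 2" using J0 by simp
      also have "prob {\<omega> \<in> space M. \<gamma> / 8 * x < t n \<omega>} \<le> \<delta> / 2" using elim(1) n by (intro less_imp_le) blast
      finally have PG: "prob G \<le> \<delta>" by simp
      have "\<omega> \<in> busy x" if \<omega>: "\<omega> \<in> space M" "regular \<omega>" "\<omega> \<in> active n" "\<alpha> * r * x < \<sigma> n \<omega>" "\<omega> \<notin> G" for \<omega>
      proof (rule takeoff_pathwise[where z="\<alpha> * r * x" and w="\<gamma> / 8 * x" and J=J and \<eta>=\<eta> and K=K and n=n])
        show "\<omega> \<notin> deviates \<eta> n (j * K)" if "j \<le> J" for j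
        proof (cases "j = 0")
          case False
          then show ?thesis using \<omega>(5) that by (auto simp: G_def)
        qed (simp add: deviates_def)
        show "t n \<omega> \<le> \<gamma> / 8 * x" using \<omega>(1,5) by (auto simp: G_def)
        have "x / a * (b - \<eta>) \<le> J * K * (b - \<eta>)" using JK(1) \<eta> by (intro mult_right_mono) auto
        moreover have "x / a * \<eta> \<le> x / a * (a * \<gamma> / 16)" using \<eta> elim(2) a_pos by (intro mult_left_mono) auto
        then have "x / a * \<eta> \<le> \<gamma> * x / 16" using a_pos by (simp add: mult_ac)
        moreover have "x / a * (b - \<eta>) = x - r * x - x / a * \<eta>"
          by (simp add: r_def right_diff_distrib left_diff_distrib)
        moreover have "0 \<le> \<gamma> * x" using \<gamma> elim(2) by simp
        ultimately show "x \<le> \<alpha> * r * x + J * K * (b - \<eta>)"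
          unfolding \<gamma>(2) distrib_right by linarith
        have "J * K * (a - b + 2 * \<eta>) \<le> (x / a + J) * (a - b + 2 * \<eta>)"
          using JK(2) \<eta> stable by (intro mult_right_mono) auto
        also have "\<dots> = r * x + 2 * (x / a * \<eta>) + J * (a - b + 2 * \<eta>)"
          using a_pos by (simp add: ra[symmetric] field_simps)
        finally have 1: "J * K * (a - b + 2 * \<eta>) \<le> r * x + 2 * (x / a * \<eta>) + J * (a - b + 2 * \<eta>)" .
        have "K * (a + \<eta>) \<le> (x / (a * J) + 1) * (a + \<eta>)"
          using K(2) \<eta> a_pos by (intro mult_right_mono) auto
        also have "\<dots> = x * (1 / J) + (x / a * \<eta>) * (1 / J) + (a + \<eta>)"
          using a_pos J0 by (simp add: field_simps)
        also have "\<dots> \<le> x * (\<gamma> / 8) + (x / a * \<eta>) * 1 + (a + \<eta>)"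
          using J0 elim(2) a_pos \<eta> by (intro add_mono mult_left_mono) auto
        finally have 2: "K * (a + \<eta>) \<le> x * (\<gamma> / 8) + x / a * \<eta> + (a + \<eta>)" by simp
        have 3: "J * (a - b + 2 * \<eta>) + (a + \<eta>) \<le> \<gamma> / 4 * x"
          using elim(4) \<gamma>(1) by (simp add: field_simps)
        show "\<gamma> / 8 * x + J * K * (a - b + 2 * \<eta>) + K * (a + \<eta>) \<le> \<alpha> * r * x"
          using 1 2 3 \<open>x / a * \<eta> \<le> \<gamma> * x / 16\<close> \<open>0 \<le> \<gamma> * x\<close> unfolding \<gamma>(2) distrib_right
          by (simp add: mult.commute[of x])
      qed (use \<omega> n \<eta> elim(2) in auto)
      then show "\<exists>G \<in> sets (info ({1..} - {n}) {n..}). prob G \<le> \<delta> \<and>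
        (\<forall>\<omega>\<in>space M. regular \<omega> \<longrightarrow> \<omega> \<in> active n \<longrightarrow> \<alpha> * (1 - b / a) * x < \<sigma> n \<omega> \<longrightarrow> \<omega> \<notin> G \<longrightarrow> \<omega> \<in> busy x)"
        using G_info PG unfolding r_def[symmetric] by blast
    qed
  qed
qed

text \<open>The takeoff events of the first \<open>N\<close> customers are made disjoint by excluding a second big jump among
them. Exclusion of a second jump and failure of the takeoff are independent of \<open>\<sigma> n\<close>, so
together they cost only a small fraction of the tail, and the probabilities add up.\<close>

lemma busy_jump_lower:
  assumes \<delta>: "\<delta> > 0"
  shows "\<forall>\<^sub>F x in at_top. (mean_served - \<delta>) * tail H (x * (1 - b / a)) \<le> prob (busy x \<inter> jump (x * (1 - b / a)))"
proof -
  define r where "r = 1 - b / a"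
  have r: "0 < r" "r < 1" using rho_bounds by (auto simp: r_def)
  define E where "E = mean_served"
  have E: "E \<ge> 1" using mean_served_ge_1 by (simp add: E_def)
  obtain N where N: "N \<ge> 1" "mean_served - \<delta> / 4 < (\<Sum>k=1..N. prob (active k))"
    using mean_served_approx[of "\<delta> / 4"] \<delta> by auto
  define S where "S = (\<Sum>k=1..N. prob (active k))"
  have S: "E - \<delta> / 4 \<le> S" "S \<le> E" using N mean_served_partial by (auto simp: S_def E_def)
  \<comment> \<open>The margin \<open>\<delta>\<close> is spent in quarters: on stopping at
      \<open>N\<close>, on the exceptional events, and on replacing \<open>z\<close> by \<open>(1
      - b / a) x\<close>.\<close>
  define \<epsilon>1 where "\<epsilon>1 = min (1 / 2) (\<delta> / (4 * E))"
  have \<epsilon>1: "\<epsilon>1 > 0" "\<epsilon>1 \<le> 1 / 2" "\<epsilon>1 * E \<le> \<delta> / 4"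
    using E \<delta> by (auto simp: \<epsilon>1_def min_def field_simps)
  obtain \<alpha> where \<alpha>: "\<alpha> > 1" "\<forall>\<^sub>F x in at_top. (1 - \<epsilon>1) * tail H x \<le> tail H (\<alpha> * x)"
    using irv_ratio[OF irv \<epsilon>1(1)] by blast
  define \<delta>' where "\<delta>' = \<delta> / (8 * N)"
  have \<delta>': "\<delta>' > 0" using \<delta> N by (simp add: \<delta>'_def)
  have s: "\<forall>\<^sub>F x in at_top. (1 - \<epsilon>1) * tail H (r * x) \<le> tail H (\<alpha> * r * x)"
    using eventually_scale[OF \<alpha>(2) r(1)] by (rule eventually_mono) (simp add: mult.assoc)
  have "\<forall>\<^sub>F y in at_top. tail H y < \<delta>' / N"
    using \<delta>' N by (intro order_tendstoD(2)[OF tail_tendsto_0]) auto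
  then have st: "\<forall>\<^sub>F x in at_top. tail H (\<alpha> * r * x) < \<delta>' / N"
    by (rule eventually_scale) (use \<alpha> r in simp)
  from s st takeoff[OF \<alpha>(1) \<delta>', of N] eventually_ge_at_top[of 0] show ?thesis
  proof eventually_elim
    case (elim x)
    define z where "z = \<alpha> * r * x"
    have zr: "r * x \<le> z"
    proof -
      have "1 * (r * x) \<le> \<alpha> * (r * x)" using \<alpha> r elim(4) by (intro mult_right_mono) auto
      then show ?thesis by (simp add: z_def mult.assoc)
    qed
    have "\<forall>n\<in>{1..N}. \<exists>G. G \<in> sets (info ({1..} - {n}) {n..}) \<and> prob G \<le> \<delta>' \<and>
      (\<forall>\<omega>\<in>space M. regular \<omega> \<longrightarrow> \<omega> \<in> active n \<longrightarrow> z < \<sigma> n \<omega> \<longrightarrow> \<omega> \<notin> G \<longrightarrow> \<omega> \<in> busy x)"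
      using elim(3) unfolding z_def r_def by blast
    from bchoice[OF this] obtain G where G0: "\<forall>n\<in>{1..N}. G n \<in> sets (info ({1..} - {n}) {n..}) \<and> prob (G n) \<le> \<delta>' \<and>
      (\<forall>\<omega>\<in>space M. regular \<omega> \<longrightarrow> \<omega> \<in> active n \<longrightarrow> z < \<sigma> n \<omega> \<longrightarrow> \<omega> \<notin> G n \<longrightarrow> \<omega> \<in> busy x)" ..
    have G: "\<And>n. n \<in> {1..N} \<Longrightarrow> G n \<in> sets (info ({1..} - {n}) {n..})"
      "\<And>n. n \<in> {1..N} \<Longrightarrow> prob (G n) \<le> \<delta>'"
      "\<And>n \<omega>. n \<in> {1..N} \<Longrightarrow> \<omega> \<in> space M \<Longrightarrow> regular \<omega> \<Longrightarrow> \<omega> \<in> active n \<Longrightarrow> z < \<sigma> n \<omega> \<Longrightarrow> \<omega> \<notin> G n \<Longrightarrow> \<omega> \<in> busy x"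
      using G0 by (simp, simp, blast)
    \<comment> \<open>Another big jump among the first \<open>N\<close> customers counts as
        exceptional as well.\<close>
    define R where "R n = G n \<union> (\<Union>k\<in>{1..N} - {n}. {\<omega> \<in> space M. z < \<sigma> k \<omega>})" for n
    have R_info: "R n \<in> sets (info ({1..} - {n}) {n..})" if n: "n \<in> {1..N}" for n
    proof -
      have "{\<omega> \<in> space M. z < \<sigma> k \<omega>} \<in> sets (info ({1..} - {n}) {n..})" if "k \<in> {1..N} - {n}" for k
        using jump_info[of z k] info_mono[of "{k}" "{1..} - {n}" "{}" "{n..}"] that by auto
      then show ?thesis unfolding R_def using G(1)[OF n] by (intro sets.Un sets.finite_UN) auto
    qed
    have R_ev[measurable]: "R n \<in> events" "G n \<in> events" if n: "n \<in> {1..N}" for n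
      using R_info[OF n] G(1)[OF n] sets_info_subset[of "{1..} - {n}" "{n..}"] n by auto
    have PR: "prob (R n) \<le> 2 * \<delta>'" if n: "n \<in> {1..N}" for n
    proof -
      have "prob (R n) \<le> prob (G n) + prob (\<Union>k\<in>{1..N} - {n}. {\<omega> \<in> space M. z < \<sigma> k \<omega>})"
        unfolding R_def using R_ev(2)[OF n] by (intro measure_Un_le) auto
      also have "prob (\<Union>k\<in>{1..N} - {n}. {\<omega> \<in> space M. z < \<sigma> k \<omega>}) \<le> (\<Sum>k\<in>{1..N} - {n}. prob {\<omega> \<in> space M. z < \<sigma> k \<omega>})"
        by (intro finite_measure_subadditive_finite) auto
      also have "\<dots> = (\<Sum>k\<in>{1..N} - {n}. tail H z)" by (intro sum.cong tail_eq) auto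
      also have "\<dots> \<le> (\<Sum>k\<in>{1..N}. tail H z)" using tail_nonneg by (intro sum_mono2) auto
      also have "\<dots> \<le> \<delta>'" using elim(2) N(1) by (simp add: z_def field_simps)
      finally show ?thesis using G(2)[OF n] by simp
    qed
    define A where "A n = {\<omega> \<in> active n. z < \<sigma> n \<omega>} - R n" for n
    have A_ev: "A n \<in> events" if "n \<in> {1..N}" for n
      unfolding A_def using that by (intro sets.Diff single_jump_events R_ev) auto
    have PA: "(prob (active n) - 2 * \<delta>') * tail H z \<le> prob (A n)" if n: "n \<in> {1..N}" for n
    proof -
      let ?J = "{\<omega> \<in> space M. z < \<sigma> n \<omega>}"
      have n1: "n \<ge> 1" using n by simp
      have J_ev: "?J \<in> events" using rv_\<sigma>[OF n1] by measurable
      have "prob {\<omega> \<in> active n. z < \<sigma> n \<omega>} \<le> prob (A n \<union> (?J \<inter> R n))"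
        using A_ev[OF n] J_ev R_ev[OF n] by (intro finite_measure_mono) (auto simp: A_def active_def)
      also have "\<dots> \<le> prob (A n) + prob (?J \<inter> R n)"
        using A_ev[OF n] J_ev R_ev[OF n] by (intro measure_Un_le) auto
      also have "prob (?J \<inter> R n) = prob ?J * prob (R n)"
        by (rule info_indep[OF jump_info R_info[OF n]]) (use n in auto)
      also have "\<dots> \<le> tail H z * (2 * \<delta>')"
        unfolding tail_eq[OF n1] using PR[OF n] tail_nonneg by (intro mult_left_mono) auto
      finally show ?thesis unfolding active_jump[OF n1] by (simp add: algebra_simps)
    qed
    have disj: "disjoint_family_on A {1..N}"
      by (auto simp: disjoint_family_on_def A_def R_def active_def)
    have "(1 - \<epsilon>1) * (S - \<delta> / 4) \<ge> E - \<delta>"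
    proof -
      have "\<epsilon>1 * S \<le> \<epsilon>1 * E" using S \<epsilon>1 by (intro mult_left_mono) auto
      moreover have "(1 - \<epsilon>1) * (S - \<delta> / 4) = S - \<delta> / 4 - \<epsilon>1 * S + \<epsilon>1 * \<delta> / 4" by (simp add: field_simps)
      moreover have "0 \<le> \<epsilon>1 * \<delta>" using \<epsilon>1 \<delta> by simp
      ultimately show ?thesis using S(1) \<epsilon>1(3) \<delta> by linarith
    qed
    show ?case
    proof (cases "S - \<delta> / 4 \<ge> 0")
      case False
      then have "(mean_served - \<delta>) * tail H (x * (1 - b / a)) \<le> 0"
        using S(1) \<delta> tail_nonneg by (intro mult_nonpos_nonneg) (auto simp: E_def)
      then show ?thesis using measure_nonneg[of M "busy x \<inter> jump (x * (1 - b / a))"] by linarith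
    next
      case True
      have "(E - \<delta>) * tail H (r * x) \<le> ((1 - \<epsilon>1) * (S - \<delta> / 4)) * tail H (r * x)"
        using \<open>(1 - \<epsilon>1) * (S - \<delta> / 4) \<ge> E - \<delta>\<close> tail_nonneg by (intro mult_right_mono)
      also have "\<dots> = (S - \<delta> / 4) * ((1 - \<epsilon>1) * tail H (r * x))" by simp
      also have "\<dots> \<le> (S - \<delta> / 4) * tail H z"
        using elim(1) True by (intro mult_left_mono) (auto simp: z_def)
      also have "\<dots> = (\<Sum>n=1..N. (prob (active n) - 2 * \<delta>') * tail H z)"
        using N(1) by (simp add: S_def \<delta>'_def sum_distrib_right[symmetric] sum_subtractf)
      also have "\<dots> \<le> (\<Sum>n=1..N. prob (A n))" by (intro sum_mono PA)
      also have "\<dots> = prob (\<Union>n\<in>{1..N}. A n)"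
        using A_ev disj by (intro finite_measure_finite_Union[symmetric]) auto
      also have "\<dots> \<le> prob (busy x \<inter> jump (r * x))"
      proof (rule prob_mono_regular)
        fix \<omega> assume \<omega>: "\<omega> \<in> space M" "regular \<omega>" "\<omega> \<in> (\<Union>n\<in>{1..N}. A n)"
        then obtain n where n: "n \<in> {1..N}" "\<omega> \<in> active n" "z < \<sigma> n \<omega>" "\<omega> \<notin> R n" by (auto simp: A_def)
        then have "\<omega> \<in> busy x" using G(3)[OF n(1) \<omega>(1,2)] by (auto simp: R_def)
        moreover have "\<omega> \<in> jump (r * x)" using n zr by (auto simp: jump_def intro!: bexI[of _ n])
        ultimately show "\<omega> \<in> busy x \<inter> jump (r * x)" by blast
      qed auto
      finally show ?thesis by (simp add: E_def r_def mult.commute)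
    qed
  qed
qed

section \<open>Asymptotics of the busy period\<close>

text \<open>The probability that a single service time is large enough to produce a busy period longer than
\<open>x\<close>; every probability below is compared with it.\<close>

definition one_jump_prob :: "real \<Rightarrow> real" where
  "one_jump_prob x = tail H (x * (1 - b / a))"

lemma one_jump_prob_pos: "0 < one_jump_prob x"
  by (simp add: one_jump_prob_def tail_pos)

text \<open>The intersection is bounded from below and each of the two events from above, with the same
constant; so all three have the same limit.\<close>

lemma ratio_limits:
  "((\<lambda>x. prob (busy x) / one_jump_prob x) \<longlongrightarrow> mean_served) at_top"
  "((\<lambda>x. prob (jump (x * (1 - b / a))) / one_jump_prob x) \<longlongrightarrow> mean_served) at_top"
  "((\<lambda>x. prob (busy x \<inter> jump (x * (1 - b / a))) / one_jump_prob x) \<longlongrightarrow> mean_served) at_top"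
proof -
  let ?J = "\<lambda>x. jump (x * (1 - b / a))"
  have both: "\<forall>\<^sub>F x in at_top. mean_served - \<delta> \<le> prob (busy x \<inter> ?J x) / one_jump_prob x" if "\<delta> > 0" for \<delta>
    using busy_jump_lower[OF that]
    by (rule eventually_mono) (simp add: one_jump_prob_def[symmetric] pos_le_divide_eq[OF one_jump_prob_pos])
  have le: "prob (busy x \<inter> ?J x) / one_jump_prob x \<le> prob (busy x) / one_jump_prob x"
    "prob (busy x \<inter> ?J x) / one_jump_prob x \<le> prob (?J x) / one_jump_prob x" for x
    by (intro divide_right_mono finite_measure_mono less_imp_le[OF one_jump_prob_pos]; auto)+
  have ub: "\<forall>\<^sub>F x in at_top. prob (busy x) / one_jump_prob x \<le> mean_served + \<delta>" if "\<delta> > 0" for \<delta>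
    using busy_upper[OF that]
    by (rule eventually_mono) (simp add: one_jump_prob_def[symmetric] pos_divide_le_eq[OF one_jump_prob_pos])
  have uj: "prob (?J x) / one_jump_prob x \<le> mean_served" for x
    using prob_jump_le[of "x * (1 - b / a)"] by (simp add: one_jump_prob_def[symmetric] pos_divide_le_eq[OF one_jump_prob_pos])
  show "((\<lambda>x. prob (busy x) / one_jump_prob x) \<longlongrightarrow> mean_served) at_top"
    by (intro tendsto_of_eventual_bounds ub eventually_mono[OF both] order_trans[OF _ le(1)])
  show "((\<lambda>x. prob (?J x) / one_jump_prob x) \<longlongrightarrow> mean_served) at_top"
    by (intro tendsto_of_eventual_bounds eventually_mono[OF both] order_trans[OF _ le(2)])
       (auto intro!: always_eventually order_trans[OF uj])
  show "((\<lambda>x. prob (busy x \<inter> ?J x) / one_jump_prob x) \<longlongrightarrow> mean_served) at_top"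
    by (intro tendsto_of_eventual_bounds both)
       (auto intro!: always_eventually order_trans[OF order_trans[OF le(2) uj]])
qed

text \<open>Intermediate regular variation leaves no room for an atom of comparable size at the threshold.\<close>

lemma closed_tail_ratio:
  "((\<lambda>x. prob {\<omega> \<in> space M. x * (1 - b / a) \<le> \<sigma> 1 \<omega>} / one_jump_prob x) \<longlongrightarrow> 1) at_top"
proof (rule tendsto_of_eventual_bounds)
  let ?c = "\<lambda>x. prob {\<omega> \<in> space M. x * (1 - b / a) \<le> \<sigma> 1 \<omega>}"
  fix \<delta> :: real assume \<delta>: "\<delta> > 0"
  have "one_jump_prob x \<le> ?c x" for x
    unfolding one_jump_prob_def tail_eq[of 1, symmetric, simplified] by (intro finite_measure_mono) auto
  then have "1 \<le> ?c x / one_jump_prob x" for x by (simp add: pos_le_divide_eq[OF one_jump_prob_pos])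
  then show "\<forall>\<^sub>F x in at_top. 1 - \<delta> \<le> ?c x / one_jump_prob x"
    using \<delta> by (intro always_eventually allI) (smt (verit))
  define r where "r = 1 - b / a"
  have r: "0 < r" "r < 1" using rho_bounds by (auto simp: r_def)
  \<comment> \<open>Chosen so that \<open>1 / (1 - \<epsilon>) = 1 + \<delta>\<close>.\<close>
  define \<epsilon> where "\<epsilon> = \<delta> / (1 + \<delta>)"
  have \<epsilon>: "\<epsilon> > 0" "(1 - \<epsilon>) * (1 + \<delta>) = 1" using \<delta> by (auto simp: \<epsilon>_def field_simps)
  obtain \<alpha> where \<alpha>: "\<alpha> > 1" "\<forall>\<^sub>F x in at_top. (1 - \<epsilon>) * tail H x \<le> tail H (\<alpha> * x)"
    using irv_ratio[OF irv \<epsilon>(1)] by blast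
  have "\<forall>\<^sub>F x in at_top. (1 - \<epsilon>) * tail H (r / \<alpha> * x) \<le> tail H (\<alpha> * (r / \<alpha> * x))"
    by (rule eventually_scale[OF \<alpha>(2)]) (use r \<alpha> in simp)
  then show "\<forall>\<^sub>F x in at_top. ?c x / one_jump_prob x \<le> 1 + \<delta>"
    using eventually_gt_at_top[of 0]
  proof eventually_elim
    case (elim x)
    have "r / \<alpha> * x < x * r" using r \<alpha> elim(2) by (simp add: field_simps)
    then have "?c x \<le> tail H (r / \<alpha> * x)"
      unfolding tail_eq[of 1, symmetric, simplified] r_def[symmetric] by (intro finite_measure_mono) auto
    then have "?c x \<le> (1 + \<delta>) * ((1 - \<epsilon>) * tail H (r / \<alpha> * x))"
      using \<epsilon>(2) by (simp add: mult.commute mult.assoc[symmetric])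
    also have "\<dots> \<le> (1 + \<delta>) * one_jump_prob x"
      using elim(1) \<alpha> \<delta> by (intro mult_left_mono) (auto simp: one_jump_prob_def r_def mult.commute)
    finally show ?case by (simp add: pos_divide_le_eq[OF one_jump_prob_pos])
  qed
qed

lemma active_closed_jump:
  assumes "n \<ge> 1"
  shows "prob {\<omega> \<in> space M. enat n \<le> num_served t \<sigma> \<omega> \<and> y \<le> \<sigma> n \<omega>} = prob (active n) * prob {\<omega> \<in> space M. y \<le> \<sigma> 1 \<omega>}"
proof -
  have "prob {\<omega> \<in> space M. y \<le> \<sigma> n \<omega>} = measure H {y..}" if "n \<ge> 1" for n
    unfolding distr_\<sigma>[OF that, symmetric] using rv_\<sigma>[OF that]
    by (subst measure_distr) (auto intro!: arg_cong[where f=prob])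
  then show ?thesis
    using active_jump_indep[OF assms, of "{y..}"] assms by (simp add: active_def Int_def conj_ac)
qed

lemma closed_jump_ratio:
  "((\<lambda>x. (\<Sum>n=1..N. prob {\<omega> \<in> space M. enat n \<le> num_served t \<sigma> \<omega> \<and> x * (1 - b / a) \<le> \<sigma> n \<omega>}) / one_jump_prob x)
    \<longlongrightarrow> (\<Sum>n=1..N. prob (active n))) at_top"
proof -
  have "((\<lambda>x. (\<Sum>n=1..N. prob (active n)) * (prob {\<omega> \<in> space M. x * (1 - b / a) \<le> \<sigma> 1 \<omega>} / one_jump_prob x))
    \<longlongrightarrow> (\<Sum>n=1..N. prob (active n)) * 1) at_top"
    by (intro tendsto_intros closed_tail_ratio)
  then show ?thesis by (simp add: active_closed_jump sum_distrib_right)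
qed

lemma nn_integral_num_served:
  "(\<integral>\<^sup>+\<omega>. ennreal_of_enat (num_served t \<sigma> \<omega>) \<partial>M) = ennreal mean_served"
proof -
  have meas: "num_served t \<sigma> \<in> measurable M (count_space UNIV)"
  proof -
    have ge: "{\<omega> \<in> space M. enat n \<le> num_served t \<sigma> \<omega>} \<in> events" for n
      using active_events[of n] by (simp add: active_def)
    have "num_served t \<sigma> -` {v} \<inter> space M \<in> events" for v
    proof (cases v)
      case (enat n)
      have "num_served t \<sigma> -` {v} \<inter> space M = {\<omega> \<in> space M. enat n \<le> num_served t \<sigma> \<omega>} - {\<omega> \<in> space M. enat (Suc n) \<le> num_served t \<sigma> \<omega>}"
        using enat by (auto simp: Suc_ile_eq)
      then show ?thesis using ge by auto
    next
      case infinity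
      have inf: "w = \<infinity> \<longleftrightarrow> (\<forall>n. enat n \<le> w)" for w 
      proof (cases w)
        case (enat k)
        have "\<not> enat (Suc k) \<le> enat k" by simp
        then show ?thesis using enat by blast
      qed simp
      have "num_served t \<sigma> -` {v} \<inter> space M = {\<omega> \<in> space M. num_served t \<sigma> \<omega> = \<infinity>}"
        using infinity by auto
      also have "\<dots> = (\<Inter>n. {\<omega> \<in> space M. enat n \<le> num_served t \<sigma> \<omega>})"
        unfolding inf by auto
      finally show ?thesis using ge by auto
    qed
    then show ?thesis by (simp add: measurable_count_space_eq_countable)
  qed
  have "(\<integral>\<^sup>+\<omega>. ennreal_of_enat (num_served t \<sigma> \<omega>) \<partial>M) = (\<Sum>n. ennreal (prob (active (Suc n))))"
    unfolding nn_integral_enat_function[OF meas] active_def Suc_ile_eq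
    by (simp add: emeasure_eq_measure)
  also have "\<dots> = ennreal mean_served"
    unfolding mean_served_def by (intro suminf_ennreal2 summable_active) auto
  finally show ?thesis .
qed

lemma active_jump_has_sum:
  "((\<lambda>n. prob (active n) * prob {\<omega> \<in> space M. y < \<sigma> n \<omega>}) has_sum mean_served * tail H y) {1..}"
proof -
  have "(\<lambda>n. prob (active (Suc n)) * tail H y) sums (mean_served * tail H y)"
    unfolding mean_served_def by (intro sums_mult2 summable_sums summable_active)
  then have "((\<lambda>n. prob (active (Suc n)) * tail H y) has_sum mean_served * tail H y) UNIV"
    by (rule sums_nonneg_imp_has_sum) (simp add: tail_nonneg)
  also have "?this \<longleftrightarrow> ((\<lambda>n. prob (active n) * prob {\<omega> \<in> space M. y < \<sigma> n \<omega>}) has_sum mean_served * tail H y) {1..}"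
    by (rule has_sum_reindex_bij_witness[where i="\<lambda>n. n - 1" and j=Suc]) (auto simp: tail_eq)
  finally show ?thesis .
qed

text \<open>The two events and their intersection have the same asymptotic probability, hence the symmetric
difference is negligible.\<close>

lemma busy_same_as_jump: "asymp_same_events M busy (\<lambda>x. jump (x * (1 - b / a)))"
proof -
  let ?J = "\<lambda>x. jump (x * (1 - b / a))"
  have E: "0 < mean_served" using mean_served_ge_1 by simp
  have pos: "\<forall>\<^sub>F x in at_top. prob (busy x) \<noteq> 0" "\<forall>\<^sub>F x in at_top. prob (?J x) \<noteq> 0"
    by (rule eventually_mono[OF order_tendstoD(1)[OF ratio_limits(1) E]], force,
        rule eventually_mono[OF order_tendstoD(1)[OF ratio_limits(2) E]], force)
  have "prob ((busy x - ?J x) \<union> (?J x - busy x)) = prob (busy x) + prob (?J x) - 2 * prob (busy x \<inter> ?J x)" for x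
  proof -
    have "prob ((busy x - ?J x) \<union> (?J x - busy x)) = prob (busy x - ?J x) + prob (?J x - busy x)"
      by (rule finite_measure_Union) auto
    moreover have "prob (busy x - ?J x) = prob (busy x) - prob (busy x \<inter> ?J x)"
      by (rule finite_measure_Diff') auto
    moreover have "prob (?J x - busy x) = prob (?J x) - prob (?J x \<inter> busy x)"
      by (rule finite_measure_Diff') auto
    ultimately show ?thesis by (simp add: Int_commute)
  qed
  then have eq: "prob ((busy x - ?J x) \<union> (?J x - busy x)) / prob (busy x) =
    (prob (busy x) / one_jump_prob x + prob (?J x) / one_jump_prob x - 2 * (prob (busy x \<inter> ?J x) / one_jump_prob x)) / (prob (busy x) / one_jump_prob x)" for x
    using one_jump_prob_pos[of x] by (simp add: add_divide_distrib[symmetric] diff_divide_distrib[symmetric])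
  have "((\<lambda>x. prob ((busy x - ?J x) \<union> (?J x - busy x)) / prob (busy x)) \<longlongrightarrow>
      (mean_served + mean_served - 2 * mean_served) / mean_served) at_top"
    unfolding eq using E by (intro tendsto_intros ratio_limits) auto
  then have "((\<lambda>x. prob ((busy x - ?J x) \<union> (?J x - busy x)) / prob (busy x)) \<longlongrightarrow> 0) at_top" by simp
  from smalloI_tendsto[OF this pos(1)] show ?thesis
    unfolding asymp_same_events_def using pos by (auto elim: eventually_elim2)
qed

end

theorem corollary3p1:
  fixes M :: "'a measure" and t \<sigma> :: "nat \<Rightarrow> 'a \<Rightarrow> real"
    and H :: "real measure" and a b \<rho> :: real
    and \<tau> :: "'a \<Rightarrow> enat" and B :: "'a \<Rightarrow> ennreal"
  assumes queue: "gi_gi_1_queue M t \<sigma> H a b"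
    and rho: "\<rho> = b / a"
    and stable: "\<rho> < 1"
    and irv: "intermediate_regularly_varying H"
    and tau: "\<tau> = num_served t \<sigma>"
    and busy: "B = busy_period t \<sigma>"
  shows
    "(\<lambda>x. \<P>(\<omega> in M. B \<omega> > ennreal x)) \<sim>[at_top]
       (\<lambda>x. \<Sum>\<^sub>\<infinity>n\<in>{1..}. \<P>(\<omega> in M. \<tau> \<omega> \<ge> enat n) * \<P>(\<omega> in M. \<sigma> n \<omega> > x * (1 - \<rho>))) \<and>
     (\<integral>\<^sup>+\<omega>. ennreal_of_enat (\<tau> \<omega>) \<partial>M) < \<infinity> \<and>
     (\<forall>x. ((\<lambda>n. \<P>(\<omega> in M. \<tau> \<omega> \<ge> enat n) * \<P>(\<omega> in M. \<sigma> n \<omega> > x * (1 - \<rho>)))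
            has_sum (enn2real (\<integral>\<^sup>+\<omega>. ennreal_of_enat (\<tau> \<omega>) \<partial>M) * \<P>(\<omega> in M. \<sigma> 1 \<omega> > x * (1 - \<rho>)))) {1..}) \<and>
     (\<forall>\<epsilon>>0. \<exists>N\<ge>1.
           (\<lambda>x. \<P>(\<omega> in M. B \<omega> > ennreal x)) \<greatersim>
             (\<lambda>x. \<Sum>n=1..N. \<P>(\<omega> in M. \<tau> \<omega> \<ge> enat n \<and> \<sigma> n \<omega> \<ge> x * (1 - \<rho>))) \<and>
           (\<epsilon> < 1 \<longrightarrow>
             (\<lambda>x. \<Sum>n=1..N. \<P>(\<omega> in M. \<tau> \<omega> \<ge> enat n \<and> \<sigma> n \<omega> \<ge> x * (1 - \<rho>))) \<greatersim>
             (\<lambda>x. (1 - \<epsilon>) * \<P>(\<omega> in M. B \<omega> > ennreal x)))) \<and>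
     asymp_same_events M
           (\<lambda>x. {\<omega> \<in> space M. B \<omega> > ennreal x})
           (\<lambda>x. \<Union>n\<in>{1..}. {\<omega> \<in> space M. \<tau> \<omega> \<ge> enat n \<and> \<sigma> n \<omega> > x * (1 - \<rho>)})"
proof -
  interpret gi_gi_1_queue M t \<sigma> H a b by (rule queue)
  have "b < a" using stable rho a_pos by (simp add: field_simps)
  then interpret stable_irv_queue M t \<sigma> H a b by unfold_locales (use irv in auto)
  have E: "1 \<le> mean_served" by (rule mean_served_ge_1)
  have sum: "((\<lambda>n. prob (active n) * prob {\<omega> \<in> space M. x * (1 - b / a) < \<sigma> n \<omega>}) has_sum mean_served * one_jump_prob x) {1..}" for x
    unfolding one_jump_prob_def by (rule active_jump_has_sum)
  have 1: "(\<lambda>x. prob (busy x)) \<sim>[at_top]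
      (\<lambda>x. \<Sum>\<^sub>\<infinity>n\<in>{1..}. prob (active n) * prob {\<omega> \<in> space M. x * (1 - b / a) < \<sigma> n \<omega>})"
    unfolding infsumI[OF sum] using ratio_limits(1) E by (intro asymp_equivI'_const) auto
  have 2: "\<exists>N\<ge>1. (\<lambda>x. prob (busy x)) \<greatersim>
      (\<lambda>x. \<Sum>n=1..N. prob {\<omega> \<in> space M. enat n \<le> num_served t \<sigma> \<omega> \<and> x * (1 - b / a) \<le> \<sigma> n \<omega>}) \<and>
    (\<epsilon> < 1 \<longrightarrow> (\<lambda>x. \<Sum>n=1..N. prob {\<omega> \<in> space M. enat n \<le> num_served t \<sigma> \<omega> \<and> x * (1 - b / a) \<le> \<sigma> n \<omega>}) \<greatersim>
      (\<lambda>x. (1 - \<epsilon>) * prob (busy x)))" if \<epsilon>: "\<epsilon> > 0" for \<epsilon> :: real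
  proof -
    obtain N where N: "N \<ge> 1" "mean_served - \<epsilon> * mean_served < (\<Sum>k=1..N. prob (active k))"
      using mean_served_approx[of "\<epsilon> * mean_served"] \<epsilon> E by auto
    have "prob (active 1) \<le> (\<Sum>k=1..N. prob (active k))"
      using N(1) by (intro member_le_sum) auto
    then have pos: "0 < (\<Sum>k=1..N. prob (active k))" by (simp add: active_1 prob_space)
    have nz: "one_jump_prob x \<noteq> 0" for x using one_jump_prob_pos[of x] by simp
    show ?thesis
    proof (intro exI[of _ N] conjI impI N(1))
      show "(\<lambda>x. prob (busy x)) \<greatersim>
        (\<lambda>x. \<Sum>n=1..N. prob {\<omega> \<in> space M. enat n \<le> num_served t \<sigma> \<omega> \<and> x * (1 - b / a) \<le> \<sigma> n \<omega>})"
        by (rule asymp_ge_of_limits[OF ratio_limits(1) closed_jump_ratio nz pos mean_served_partial])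
      assume \<epsilon>1: "\<epsilon> < 1"
      have "((\<lambda>x. (1 - \<epsilon>) * prob (busy x) / one_jump_prob x) \<longlongrightarrow> (1 - \<epsilon>) * mean_served) at_top"
        using tendsto_mult[OF tendsto_const[of "1 - \<epsilon>"] ratio_limits(1)] by simp
      then show "(\<lambda>x. \<Sum>n=1..N. prob {\<omega> \<in> space M. enat n \<le> num_served t \<sigma> \<omega> \<and> x * (1 - b / a) \<le> \<sigma> n \<omega>}) \<greatersim>
        (\<lambda>x. (1 - \<epsilon>) * prob (busy x))"
        by (rule asymp_ge_of_limits[OF closed_jump_ratio _ nz])
           (use N(2) E \<epsilon>1 in \<open>auto simp: algebra_simps\<close>)
    qed
  qed
  have jump: "jump y = (\<Union>n\<in>{1..}. {\<omega> \<in> space M. enat n \<le> num_served t \<sigma> \<omega> \<and> y < \<sigma> n \<omega>})" for y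
    by (auto simp: jump_def active_def)
  have int: "enn2real (\<integral>\<^sup>+\<omega>. ennreal_of_enat (num_served t \<sigma> \<omega>) \<partial>M) = mean_served"
    unfolding nn_integral_num_served using E by simp
  have tail1: "prob {\<omega> \<in> space M. x * (1 - b / a) < \<sigma> 1 \<omega>} = one_jump_prob x" for x
    unfolding one_jump_prob_def by (rule tail_eq) simp
  show ?thesis
    unfolding tau busy rho int tail1
    using 1 2 sum busy_same_as_jump unfolding active_def jump nn_integral_num_served
    by (intro conjI allI impI) (blast | simp)+
qed

end
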